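(* Let $\varepsilon>0$ be fixed. Assume that $\varepsilon\le\zeta\le \pi-\varepsilon$ and that $\nu\in \mathbb{C}$ is bounded. Then, as $\Re \mu\to+\infty$ with $\Im \mu$ bounded, the Ferrers functions have the inverse factorial expansions $$\begin{aligned}\mathsf{P}_{\nu} ^{\mu} (\cos \zeta ) \sim \; & \frac{\sin(\pi\mu)}{\pi}\cot^\mu\left(\tfrac{1}{2}\zeta\right)\sum_{n=0}^\infty a_n\left(\nu+\tfrac12\right)\Gamma(\mu-n)\left(2\sin^2\left(\tfrac{1}{2}\zeta\right)\right)^n\\& -\frac{\sin(\pi\nu)}{\pi}\tan^{\mu}\left(\tfrac{1}{2}\zeta\right)\sum_{n=0}^\infty a_n\left(\nu+\tfrac12\right)\Gamma(\mu-n)\left(2\cos^2\left(\tfrac{1}{2}\zeta\right)\right)^n,\end{aligned}$$ $$\begin{aligned}\mathsf{Q}_{\nu} ^{\mu} (\cos \zeta ) \sim \; & \frac{\cos(\pi\mu)}{2}\cot^\mu\left(\tfrac{1}{2}\zeta\right)\sum_{n=0}^\infty a_n\left(\nu+\tfrac12\right)\Gamma(\mu-n)\left(2\sin^2\left(\tfrac{1}{2}\zeta\right)\right)^n\\& - \frac{\cos(\pi\nu)}{2}\tan^\mu\left(\tfrac{1}{2}\zeta\right)\sum_{n=0}^\infty a_n\left(\nu+\tfrac12\right)\Gamma(\mu-n)\left(2\cos^2\left(\tfrac{1}{2}\zeta\right)\right)^n.\end{aligned}$$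
   Context: Meaning of $\sim$: an expansion $f\sim A\sum_{n\ge0} s_n + B\sum_{n\ge0} t_n$ with $s_n=a_n(\nu+\frac12)\Gamma(\mu-n)X^n$, $t_n=a_n(\nu+\frac12)\Gamma(\mu-n)Y^n$ means that for all fixed non-negative integers $N,M$ one can write $f=A\left(\sum_{n=0}^{N-1}s_n+\mathcal{O}(|\Gamma(\mu-N)||X|^N)\right)+B\left(\sum_{m=0}^{M-1}t_m+\mathcal{O}(|\Gamma(\mu-M)||Y|^M)\right)$ in the stated limit, with implied constants uniform over $\zeta\in[\varepsilon,\pi-\varepsilon]$, $\nu$ in a fixed bounded set and $\Im\mu$ in a fixed bounded set. The Ferrers functions are defined for $-1<x<1$ by $$\mathsf{P}_\nu ^\mu (x) = \left( \frac{1 + x}{1 - x} \right)^{\mu /2} \mathbf{F}\left(\nu+1,-\nu;1-\mu;\tfrac{1-x}{2}\right)$$ and, for $\nu+\mu\notin\mathbb{Z}_{<0}$, $$\mathsf{Q}_\nu ^\mu (x) = \frac{\pi }{2\sin (\pi \mu )}\left( \cos (\pi \mu )\left( \frac{1 + x}{1 - x}\right)^{\mu /2} \mathbf{F}\left(\nu+1,-\nu;1-\mu;\tfrac{1-x}{2}\right)- \frac{\Gamma (\nu + \mu + 1)}{\Gamma (\nu - \mu + 1)}\left( \frac{1 - x}{1 + x} \right)^{\mu /2} \mathbf{F}\left(\nu+1,-\nu;1+\mu;\tfrac{1-x}{2}\right)\right)$$ (limiting value when $\mu$ is an integer), where $\mathbf{F}(a,b;c;w)=\sum_{n\ge 0}\frac{(a)_n(b)_n}{\Gamma(c+n)\,n!}w^n$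 ($|w|<1$) is the regularised hypergeometric function. $a_n (\mu ) = \frac{(4\mu ^2 - 1^2 )(4\mu ^2 - 3^2 ) \cdots (4\mu ^2 - (2n - 1)^2 )}{8^n n!}$. *)

theory Defs
  imports "HOL-Analysis.Analysis"
begin

text \<open>Regularised hypergeometric function, meant for \<open>norm w < 1\<close>. The entire function
  \<^const>\<open>rGamma\<close> is used so that \<open>1/\<Gamma>(c+n)\<close> is \<open>0\<close> when \<open>c+n\<close> is a pole of \<open>\<Gamma>\<close>.\<close>

definition hyp_reg :: "complex \<Rightarrow> complex \<Rightarrow> complex \<Rightarrow> complex \<Rightarrow> complex" where
  "hyp_reg a b c w =
     (\<Sum>n. pochhammer a n * pochhammer b n * rGamma (c + of_nat n) / fact n * w ^ n)"

text \<open>Ferrers functions of degree \<open>\<nu>\<close> and order \<open>\<mu>\<close>, meant for \<open>-1 < x < 1\<close>.\<close>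

definition ferrers_P :: "complex \<Rightarrow> complex \<Rightarrow> real \<Rightarrow> complex" where
  "ferrers_P \<nu> \<mu> x =
     of_real ((1 + x) / (1 - x)) powr (\<mu> / 2) *
     hyp_reg (\<nu> + 1) (-\<nu>) (1 - \<mu>) (of_real ((1 - x) / 2))"

text \<open>The defining formula of the second function for non-integer \<open>\<mu>\<close>; \<open>\<nu> + \<mu>\<close> must not be
  a negative integer.\<close>

definition ferrers_Q_formula :: "complex \<Rightarrow> complex \<Rightarrow> real \<Rightarrow> complex" where
  "ferrers_Q_formula \<nu> \<mu> x =
     of_real pi / (2 * sin (of_real pi * \<mu>)) *
     (cos (of_real pi * \<mu>) * of_real ((1 + x) / (1 - x)) powr (\<mu> / 2) *
        hyp_reg (\<nu> + 1) (-\<nu>) (1 - \<mu>) (of_real ((1 - x) / 2))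
      - Gamma (\<nu> + \<mu> + 1) * rGamma (\<nu> - \<mu> + 1) *
        of_real ((1 - x) / (1 + x)) powr (\<mu> / 2) *
        hyp_reg (\<nu> + 1) (-\<nu>) (1 + \<mu>) (of_real ((1 - x) / 2)))"

definition ferrers_Q :: "complex \<Rightarrow> complex \<Rightarrow> real \<Rightarrow> complex" where
  "ferrers_Q \<nu> \<mu> x =
     (if \<mu> \<in> \<int> then Lim (at \<mu>) (\<lambda>m. ferrers_Q_formula \<nu> m x)
      else ferrers_Q_formula \<nu> \<mu> x)"

definition a_coeff :: "nat \<Rightarrow> complex \<Rightarrow> complex" where
  "a_coeff n \<mu> = (\<Prod>k = 1..n. 4 * \<mu>\<^sup>2 - (2 * of_nat k - 1)\<^sup>2) / (8 ^ n * fact n)"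

text \<open>The relation
  \<open>f \<sim> A \<Sum>\<^sub>n a\<^sub>n(\<nu>+1/2) \<Gamma>(\<mu>-n) X\<^sup>n + B \<Sum>\<^sub>n a\<^sub>n(\<nu>+1/2) \<Gamma>(\<mu>-n) Y\<^sup>n\<close>
  as \<open>Re \<mu> \<rightarrow> +\<infinity>\<close> with \<open>Im \<mu> \<in> T\<close>, uniformly in \<open>\<zeta> \<in> Z\<close> and \<open>\<nu> \<in> V\<close>: both series may be
  truncated independently, and \<open>E\<^sub>1\<close>, \<open>E\<^sub>2\<close> are the two \<open>\<O>\<close>-terms. The functions \<open>f\<close>, \<open>A\<close>, \<open>B\<close>
  take the arguments \<open>\<zeta>\<close>, \<open>\<nu>\<close>, \<open>\<mu>\<close> in this order; \<open>X\<close>, \<open>Y\<close> depend on \<open>\<zeta>\<close> only.\<close>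

definition inverse_factorial_expansion ::
  "real set \<Rightarrow> complex set \<Rightarrow> real set \<Rightarrow>
   (real \<Rightarrow> complex \<Rightarrow> complex \<Rightarrow> complex) \<Rightarrow>
   (real \<Rightarrow> complex \<Rightarrow> complex \<Rightarrow> complex) \<Rightarrow> (real \<Rightarrow> real) \<Rightarrow>
   (real \<Rightarrow> complex \<Rightarrow> complex \<Rightarrow> complex) \<Rightarrow> (real \<Rightarrow> real) \<Rightarrow> bool" where
  "inverse_factorial_expansion Z V T f A X B Y \<longleftrightarrow>
     (\<forall>N M. \<exists>C R. \<forall>\<zeta>\<in>Z. \<forall>\<nu>\<in>V. \<forall>\<mu>. Im \<mu> \<in> T \<and> Re \<mu> \<ge> R \<longrightarrow>
        (\<exists>E\<^sub>1 E\<^sub>2.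
           norm E\<^sub>1 \<le> C * (norm (Gamma (\<mu> - of_nat N)) * \<bar>X \<zeta>\<bar> ^ N) \<and>
           norm E\<^sub>2 \<le> C * (norm (Gamma (\<mu> - of_nat M)) * \<bar>Y \<zeta>\<bar> ^ M) \<and>
           f \<zeta> \<nu> \<mu> =
             A \<zeta> \<nu> \<mu> * ((\<Sum>n<N. a_coeff n (\<nu> + 1/2) * Gamma (\<mu> - of_nat n) * of_real (X \<zeta>) ^ n) + E\<^sub>1)
           + B \<zeta> \<nu> \<mu> * ((\<Sum>m<M. a_coeff m (\<nu> + 1/2) * Gamma (\<mu> - of_nat m) * of_real (Y \<zeta>) ^ m) + E\<^sub>2)))"

end

theory Submission
  imports Defs "HOL-Real_Asymp.Real_Asymp"
begin

text \<open>
  Put \<open>G(\<mu>,y) = \<Gamma>(\<mu>+\<nu>+1) \<Gamma>(\<mu>-\<nu>) F(\<nu>+1,-\<nu>;1+\<mu>;1-y)\<close> with \<open>F\<close> regularised. Expanding each power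
  \<open>(1-y)\<^sup>k\<close> of the series by the binomial theorem and summing over \<open>k\<close> with Gauss's theorem gives
  \<open>G(\<mu>,y) = \<Sum>\<^sub>n\<^sub><\<^sub>N a\<^sub>n(\<nu>+1/2) \<Gamma>(\<mu>-n) (2y)\<^sup>n + O(\<Gamma>(\<mu>-N) y\<^sup>N)\<close>, where Gauss's theorem also supplies the
  ratio of Gamma functions in the error term, so that Stirling's formula is not needed.

  With \<open>s = sin\<^sup>2(\<zeta>/2)\<close>, both Ferrers functions are exact combinations of \<open>cot\<^sup>\<mu>(\<zeta>/2) G(\<mu>,s)\<close> and
  \<open>tan\<^sup>\<mu>(\<zeta>/2) G(\<mu>,1-s)\<close>. For \<open>P\<close> this is Kummer's connection formula: three solutions \<open>f\<close>, \<open>g\<close>, \<open>h\<close> of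
  Legendre's equation satisfy \<open>h W(f,g) + f W(g,h) + g W(h,f) = 0\<close>, and the constant Wronskians are read
  off at the singular points, using an Abelian theorem at the point where \<open>F(\<nu>+1,-\<nu>;1-\<mu>;\<cdot>)\<close> blows up.
  For \<open>Q\<close> the formula then follows from its definition, and extends to integer \<open>\<mu>\<close> because \<open>G\<close> is
  continuous in \<open>\<mu>\<close>.
\<close>

subsection \<open>Coefficients of the hypergeometric series\<close>

definition hyp_coeff :: "complex \<Rightarrow> complex \<Rightarrow> complex \<Rightarrow> nat \<Rightarrow> complex" where
  "hyp_coeff a b c n = pochhammer a n * pochhammer b n * rGamma (c + of_nat n) / fact n"

lemma hyp_reg_altdef: "hyp_reg a b c w = (\<Sum>n. hyp_coeff a b c n * w ^ n)"
  by (simp add: hyp_reg_def hyp_coeff_def)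

lemma hyp_coeff_0 [simp]: "hyp_coeff a b c 0 = rGamma c"
  by (simp add: hyp_coeff_def)

text \<open>The recurrence is kept free of division so that it also holds when
  \<open>c + of_nat k = 0\<close>, which occurs for \<open>c = 1 - \<mu>\<close> at positive
  integers \<open>\<mu>\<close>.\<close>

lemma hyp_coeff_Suc:
  "(c + of_nat k) * of_nat (Suc k) * hyp_coeff a b c (Suc k)
     = (a + of_nat k) * (b + of_nat k) * hyp_coeff a b c k"
proof -
  have r: "rGamma (c + of_nat k) = (c + of_nat k) * rGamma (c + of_nat (Suc k))"
    using rGamma_plus1[of "c + of_nat k"] by (simp add: add_ac)
  have "of_nat (Suc k) / fact (Suc k) = (1 :: complex) / fact k"
    by (simp del: of_nat_Suc)
  then show ?thesis
    unfolding hyp_coeff_def r pochhammer_Suc by (simp add: field_simps del: of_nat_Suc)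
qed

text \<open>Binomial weights merely shift all three parameters by \<open>n\<close>. This evaluates
  the sums left by expanding \<open>(1 - y) ^ k\<close>, and the case \<open>n = 1\<close> gives the
  derivative of the series.\<close>

lemma hyp_coeff_shift:
  "of_nat (k + n choose n) * hyp_coeff a b c (k + n) =
     pochhammer a n * pochhammer b n / fact n *
       hyp_coeff (a + of_nat n) (b + of_nat n) (c + of_nat n) k"
proof -
  have "of_nat (k + n choose n) / fact (k + n) = (1 :: complex) / (fact n * fact k)"
    using binomial_fact[of n "k + n", where 'a = complex] by simp
  moreover have "pochhammer z (k + n) = pochhammer z n * pochhammer (z + of_nat n) k" for z :: complex
    by (metis add.commute pochhammer_product')
  ultimately show ?thesis
    unfolding hyp_coeff_def by (simp add: field_simps)
qed

lemma hyp_coeff_shift_1: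
  "of_nat (Suc k) * hyp_coeff a b c (Suc k) = a * b * hyp_coeff (a + 1) (b + 1) (c + 1) k"
proof -
  have "of_nat (k + 1 choose 1) = (of_nat (Suc k) :: complex)" by simp
  then show ?thesis using hyp_coeff_shift[of k 1 a b c] by (simp only: pochhammer_1 fact_1 of_nat_1 div_by_1 Suc_eq_plus1)
qed

text \<open>The lower bound on \<open>Re c\<close> makes consecutive coefficients decrease at least as fast as
  \<open>1/((k+1)(k+2))\<close>: it is chosen so that \<open>(A+j)\<^sup>2(j+3) \<le> (Re c+j)(j+1)\<^sup>2\<close> for all \<open>j\<close>.\<close>

lemma norm_hyp_coeff_Suc_le:
  assumes A: "norm a \<le> A" "norm b \<le> A" and c: "Re c \<ge> 6 * A\<^sup>2 + 6 * A + 1"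
  shows "norm (hyp_coeff a b c (Suc k))
           \<le> norm (rGamma c) * (6 * A\<^sup>2 / Re c) / (of_nat (k + 2) * of_nat (k + 3))"
proof (induction k)
  have A0: "A \<ge> 0" using A(1) norm_ge_zero order_trans by blast
  then have cpos: "Re c > 0" using c by (smt (verit) zero_le_power2)
  {
    case 0
    \<comment> \<open>The factor 6 in the bound offsets the denominator \<open>2 * 3\<close> at
      \<open>k = 0\<close>.\<close>
    have "norm (c * hyp_coeff a b c 1) = norm (a * b * rGamma c)"
      using hyp_coeff_Suc[of c 0 a b] by simp
    then have "norm c * norm (hyp_coeff a b c 1) = norm a * norm b * norm (rGamma c)"
      by (simp add: norm_mult)
    also have "\<dots> \<le> A * A * norm (rGamma c)"
      using A A0 by (intro mult_mono) auto
    finally have "Re c * norm (hyp_coeff a b c 1) \<le> A * A * norm (rGamma c)"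
      using mult_right_mono[OF complex_Re_le_cmod[of c] norm_ge_zero[of "hyp_coeff a b c 1"]]
      by linarith
    then show ?case using cpos by (simp add: field_simps power2_eq_square)
  next
    case (Suc k)
    \<comment> \<open>In terms of \<open>j\<close> the induction hypothesis is
      \<open>h \<le> K / ((j + 1) * (j + 2))\<close> and the goal is
      \<open>h' \<le> K / ((j + 2) * (j + 3))\<close>.\<close>
    define j where "j = real (Suc k)"
    have j: "j \<ge> 1" by (simp add: j_def)
    define h where "h = norm (hyp_coeff a b c (Suc k))"
    define h' where "h' = norm (hyp_coeff a b c (Suc (Suc k)))"
    define K where "K = norm (rGamma c) * (6 * A\<^sup>2 / Re c)"
    have K0: "K \<ge> 0" using cpos by (simp add: K_def)
    have "norm ((c + of_nat (Suc k)) * of_nat (Suc (Suc k)) * hyp_coeff a b c (Suc (Suc k)))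
        = norm ((a + of_nat (Suc k)) * (b + of_nat (Suc k)) * hyp_coeff a b c (Suc k))"
      by (simp only: hyp_coeff_Suc)
    then have e: "norm (c + of_nat (Suc k)) * (j + 1) * h'
        = norm (a + of_nat (Suc k)) * norm (b + of_nat (Suc k)) * h"
      unfolding norm_mult norm_of_nat h_def h'_def j_def by simp
    have n1: "norm (a + of_nat (Suc k)) \<le> A + j" "norm (b + of_nat (Suc k)) \<le> A + j"
      using norm_triangle_ineq[of a "of_nat (Suc k)"] norm_triangle_ineq[of b "of_nat (Suc k)"] A
      unfolding j_def norm_of_nat by linarith+
    have n2: "Re c + j \<le> norm (c + of_nat (Suc k))"
      using complex_Re_le_cmod[of "c + of_nat (Suc k)"] by (simp add: j_def)
    have "(Re c + j) * ((j + 1) * h') \<le> norm (c + of_nat (Suc k)) * ((j + 1) * h')"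
      using n2 j by (intro mult_right_mono) (auto simp: h'_def)
    also have "\<dots> = norm (a + of_nat (Suc k)) * norm (b + of_nat (Suc k)) * h"
      using e by (simp add: mult_ac)
    also have "\<dots> \<le> (A + j) * (A + j) * h"
      using n1 A0 j by (intro mult_mono) (auto simp: h_def)
    also have "\<dots> \<le> (A + j) * (A + j) * (K / ((j + 1) * (j + 2)))"
      using Suc A0 j unfolding h_def K_def j_def
      by (intro mult_left_mono) (auto simp: algebra_simps)
    finally have 1: "(Re c + j) * ((j + 1) * h') \<le> (A + j) * (A + j) * (K / ((j + 1) * (j + 2)))" .
    have "(A + j) * (A + j) * (j + 3) \<le> (Re c + j) * (j + 1)\<^sup>2"
    proof -
      have "A\<^sup>2 * j \<ge> 0" "A * j \<ge> 0" "A * j^2 \<ge> 0" "A\<^sup>2 * j\<^sup>2 \<ge> 0" "A\<^sup>2 \<ge> 0" using A0 j by auto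
      then have "(A + j) * (A + j) * (j + 3) \<le> (6 * A\<^sup>2 + 6 * A + 1 + j) * (j + 1)\<^sup>2"
        using A0 j by (simp add: power2_eq_square algebra_simps)
      also have "\<dots> \<le> (Re c + j) * (j + 1)\<^sup>2"
        using c by (intro mult_right_mono) auto
      finally show ?thesis .
    qed
    then have "(A + j) * (A + j) * (K / ((j + 1) * (j + 2))) * (j + 3) 
        \<le> (Re c + j) * (j + 1)\<^sup>2 * (K / ((j + 1) * (j + 2)))"
      using mult_right_mono[of "(A + j) * (A + j) * (j + 3)" "(Re c + j) * (j + 1)\<^sup>2" "K / ((j + 1) * (j + 2))"]
        K0 j by (simp add: mult_ac)
    with 1 j have "(Re c + j) * ((j + 1) * h') * (j + 3) \<le> (Re c + j) * (j + 1)\<^sup>2 * (K / ((j + 1) * (j + 2)))"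
      by (smt (verit) mult_right_mono)
    moreover have "(Re c + j) * (j + 1)\<^sup>2 * (K / ((j + 1) * (j + 2))) = (Re c + j) * (j + 1) * (K / (j + 2))"
      using j by (simp add: power2_eq_square)
    ultimately have "(Re c + j) * (j + 1) * (h' * (j + 3)) \<le> (Re c + j) * (j + 1) * (K / (j + 2))"
      by (simp only: mult_ac)
    then have "h' * (j + 3) \<le> K / (j + 2)"
      using cpos j by (subst (asm) mult_le_cancel_left_pos) auto
    then have "h' \<le> K / ((j + 2) * (j + 3))" using j by (simp add: le_divide_eq mult_ac)
    then show ?case by (simp add: h'_def K_def j_def algebra_simps)
  }
qed

section \<open>Absolute convergence and contiguity at the point 1\<close>

lemma sums_inverse_product: "(\<lambda>k. 1 / (of_nat (k + 2) * of_nat (k + 3)) :: real) sums (1 / 2)"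
proof -
  have "(\<lambda>k. 1 / of_nat (k + 2) :: real) \<longlonglongrightarrow> 0"
    by real_asymp
  moreover have "1 / of_nat (k + 2) - 1 / of_nat (Suc k + 2) = (1 / (of_nat (k + 2) * of_nat (k + 3)) :: real)" for k
    by (simp add: divide_simps)
  ultimately show ?thesis
    using telescope_sums'[of "\<lambda>k. 1 / of_nat (k + 2) :: real" 0] by simp
qed

text \<open>For \<open>Re c\<close> this large the first term \<open>rGamma c\<close> dominates: the
  others are majorised by a telescoping series with sum \<open>K / 2\<close>. The third bound has
  the extra factor \<open>1 / Re c\<close> that drives the limit in Gauss's theorem.\<close>

lemma hyp_coeff_sum_bounds:
  assumes A: "norm a \<le> A" "norm b \<le> A" and c: "Re c \<ge> 6 * A\<^sup>2 + 6 * A + 1"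
  shows "summable (\<lambda>k. norm (hyp_coeff a b c k))"
    and "(\<Sum>k. norm (hyp_coeff a b c k)) \<le> 3 / 2 * norm (rGamma c)"
    and "norm ((\<Sum>k. hyp_coeff a b c k) - rGamma c) \<le> norm (rGamma c) * (3 * A\<^sup>2 / Re c)"
proof -
  define K where "K = norm (rGamma c) * (6 * A\<^sup>2 / Re c)"
  have A0: "A \<ge> 0" using A(1) norm_ge_zero order_trans by blast
  then have cpos: "Re c > 0" using c by (smt (verit) zero_le_power2)
  have s: "(\<lambda>k. K * (1 / (of_nat (k + 2) * of_nat (k + 3)))) sums (K * (1/2))"
    by (intro sums_mult sums_inverse_product)
  have le: "norm (hyp_coeff a b c (Suc k)) \<le> K * (1 / (of_nat (k + 2) * of_nat (k + 3)))" for k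
    using norm_hyp_coeff_Suc_le[OF A c, of k] by (simp add: K_def)
  have sm: "summable (\<lambda>k. norm (hyp_coeff a b c (Suc k)))"
    using le by (intro summable_comparison_test'[OF sums_summable[OF s], of 0]) auto
  then show sm0: "summable (\<lambda>k. norm (hyp_coeff a b c k))"
    by (subst (asm) summable_Suc_iff)
  have le2: "(\<Sum>k. norm (hyp_coeff a b c (Suc k))) \<le> K / 2"
    using suminf_le[OF le sm sums_summable[OF s]] sums_unique[OF s] by simp
  have "6 * A\<^sup>2 / Re c \<le> 1"
    using c cpos A0 by (simp add: field_simps)
  then have K1: "K \<le> norm (rGamma c)"
    unfolding K_def using mult_left_mono[of "6 * A\<^sup>2 / Re c" 1 "norm (rGamma c)"] by simp
  show "(\<Sum>k. norm (hyp_coeff a b c k)) \<le> 3 / 2 * norm (rGamma c)"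
    using suminf_split_head[OF sm0] le2 K1 by simp
  have "norm (\<Sum>k. hyp_coeff a b c (Suc k)) \<le> K / 2"
    using summable_norm[OF sm] le2 by simp
  then show "norm ((\<Sum>k. hyp_coeff a b c k) - rGamma c) \<le> norm (rGamma c) * (3 * A\<^sup>2 / Re c)"
    using suminf_split_head[OF summable_norm_cancel[OF sm0]] by (simp add: K_def mult_ac)
qed

text \<open>Supplies the vanishing boundary term of the telescoping sum in
  \<open>hyp_reg_1_contiguous\<close>.\<close>

lemma hyp_coeff_times_index_tendsto_0:
  assumes A: "norm a \<le> A" "norm b \<le> A" and c: "Re c \<ge> 6 * A\<^sup>2 + 6 * A + 1"
  shows "(\<lambda>k. of_nat k * hyp_coeff a b c k) \<longlonglongrightarrow> 0"
proof (rule LIMSEQ_imp_Suc)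
  define K where "K = norm (rGamma c) * (6 * A\<^sup>2 / Re c)"
  have le: "norm (of_nat (Suc k) * hyp_coeff a b c (Suc k)) \<le> K / of_nat (k + 3)" for k
  proof -
    have "norm (of_nat (Suc k) * hyp_coeff a b c (Suc k)) = of_nat (k + 1) * norm (hyp_coeff a b c (Suc k))"
      by (simp add: norm_mult del: of_nat_Suc)
    also have "\<dots> \<le> of_nat (k + 2) * norm (hyp_coeff a b c (Suc k))"
      by (intro mult_right_mono) auto
    also have "\<dots> \<le> of_nat (k + 2) * (K / (of_nat (k + 2) * of_nat (k + 3)))"
      using norm_hyp_coeff_Suc_le[OF A c, of k] by (intro mult_left_mono) (auto simp: K_def)
    also have "\<dots> = K / of_nat (k + 3)"
      using mult_divide_mult_cancel_left[of "real (k + 2)" K "real (k + 3)"]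
      by (simp only: times_divide_eq_right)
    finally show ?thesis .
  qed
  have "(\<lambda>k. K / of_nat (k + 3)) \<longlonglongrightarrow> 0" by real_asymp
  then show "(\<lambda>k. of_nat (Suc k) * hyp_coeff a b c (Suc k)) \<longlonglongrightarrow> 0"
    by (rule Lim_null_comparison[rotated]) (use le in auto)
qed

text \<open>Iterating this relation sends the third parameter to infinity, where the series is
  asymptotic to its first term.\<close>

lemma hyp_reg_1_contiguous:
  assumes A: "norm a \<le> A" "norm b \<le> A" and c: "Re c \<ge> 6 * A\<^sup>2 + 6 * A + 1"
  shows "(c - a - b) * hyp_reg a b c 1 = (c - a) * (c - b) * hyp_reg a b (c + 1) 1"
proof -
  have c': "Re (c + 1) \<ge> 6 * A\<^sup>2 + 6 * A + 1" using c by simp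
  let ?t = "hyp_coeff a b c" and ?t' = "hyp_coeff a b (c + 1)"
  have s: "?t sums hyp_reg a b c 1" "?t' sums hyp_reg a b (c + 1) 1"
    using hyp_coeff_sum_bounds(1)[OF A c] hyp_coeff_sum_bounds(1)[OF A c']
    by (auto simp: hyp_reg_altdef intro!: summable_sums summable_norm_cancel)
  have rel: "?t k = (c + of_nat k) * ?t' k" for k
    using rGamma_plus1[of "c + of_nat k"] by (simp add: hyp_coeff_def add_ac)
  \<comment> \<open>The difference of the two series telescopes, with \<open>k * ?t k\<close> as antidifference.\<close>
  have "(c - a - b) * ?t k - (c - a) * (c - b) * ?t' k
          = of_nat k * ?t k - of_nat (Suc k) * ?t (Suc k)" for k
  proof (cases "c + of_nat k = 0")
    case False
    have "(c + of_nat k) * (of_nat (Suc k) * ?t (Suc k))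
        = (c + of_nat k) * ((a + of_nat k) * (b + of_nat k) * ?t' k)"
      using hyp_coeff_Suc[of c k a b] rel[of k] by (simp add: mult_ac)
    then have "of_nat (Suc k) * ?t (Suc k) = (a + of_nat k) * (b + of_nat k) * ?t' k"
      using False by (metis mult_left_cancel)
    then show ?thesis unfolding rel[of k] by (simp add: algebra_simps)
  next
    case True
    have "A \<ge> 0" using A(1) norm_ge_zero order_trans by blast
    then have "Re (c + of_nat k) > 0" using c by (simp add: add_pos_nonneg) (smt (verit) zero_le_power2 of_nat_0_le_iff)
    with True show ?thesis by simp
  qed
  moreover have "(\<lambda>k. of_nat k * ?t k - of_nat (Suc k) * ?t (Suc k)) sums (of_nat 0 * ?t 0 - 0)"
    by (rule telescope_sums'[OF hyp_coeff_times_index_tendsto_0[OF A c]])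
  moreover have "(\<lambda>k. (c - a - b) * ?t k - (c - a) * (c - b) * ?t' k) sums
      ((c - a - b) * hyp_reg a b c 1 - (c - a) * (c - b) * hyp_reg a b (c + 1) 1)"
    by (intro sums_diff sums_mult s)
  ultimately show ?thesis using sums_unique2 by force
qed

text \<open>For \<open>Re z > 0\<close> this is Euler's limit for \<open>rGamma z\<close> divided by
  its value. The induction then moves left in unit steps and also reaches the poles of Gamma, where
  division by \<open>rGamma z\<close> is impossible.\<close>

lemma rGamma_asymptotic:
  fixes z :: complex
  shows "(\<lambda>n. rGamma (z + of_nat (Suc n)) * fact n * exp (z * of_real (ln (of_nat n)))) \<longlonglongrightarrow> 1"
proof -
  have base: "(\<lambda>n. rGamma (z + of_nat (Suc n)) * fact n * exp (z * of_real (ln (of_nat n)))) \<longlonglongrightarrow> 1"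
    if "Re z > 0" for z
  proof -
    have z: "z \<notin> \<int>\<^sub>\<le>\<^sub>0" using that by (auto elim!: nonpos_Ints_cases)
    then have nz: "rGamma z \<noteq> 0" by (simp add: rGamma_eq_zero_iff)
    have "(\<lambda>n. rGamma z / rGamma_series z n) \<longlonglongrightarrow> rGamma z / rGamma z"
      by (intro tendsto_intros nz)
    moreover have "rGamma z / rGamma_series z n
        = rGamma (z + of_nat (Suc n)) * fact n * exp (z * of_real (ln (of_nat n)))" for n
    proof -
      have "pochhammer z (Suc n) \<noteq> 0" using nz pochhammer_rGamma[of z "Suc n"] by auto
      then show ?thesis using pochhammer_rGamma[of z "Suc n"]
        by (simp add: rGamma_series_def field_simps del: of_nat_Suc)
    qed
    ultimately show ?thesis using nz by simp
  qed
  have "(\<lambda>n. rGamma (z + of_nat (Suc n)) * fact n * exp (z * of_real (ln (of_nat n)))) \<longlonglongrightarrow> 1"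
    if "Re (z + of_nat m) > 0" for m z
    using that
  proof (induction m arbitrary: z)
    case 0
    then show ?case using base by simp
  next
    case (Suc m)
    let ?f = "\<lambda>z n. rGamma (z + of_nat (Suc n)) * fact n * exp (z * of_real (ln (of_nat n)))"
    have IH: "?f (z + 1) \<longlonglongrightarrow> 1"
      using Suc.prems by (intro Suc.IH) (simp add: add_ac)
    show ?case
    proof (rule LIMSEQ_imp_Suc)
      have "(\<lambda>n::nat. ln (real (Suc n)) - ln (real n)) \<longlonglongrightarrow> 0" by real_asymp
      moreover have "(\<lambda>n::nat. real (Suc n) / real n) \<longlonglongrightarrow> 1" by real_asymp
      \<comment> \<open>The term for \<open>(z, n + 1)\<close> is the term for
        \<open>(z + 1, n)\<close> times a factor tending to 1. The two are compared for
        \<open>n > 0\<close> only, since the factor divides by \<open>n\<close>.\<close>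
      ultimately have "(\<lambda>n. ?f (z + 1) n * (of_real (real (Suc n) / real n) *
             exp (z * of_real (ln (real (Suc n)) - ln (real n))))) \<longlonglongrightarrow> 1 * (of_real 1 * exp (z * of_real 0))"
        by (intro tendsto_mult IH tendsto_of_real tendsto_exp tendsto_const)
      moreover have "\<forall>\<^sub>F n in sequentially. ?f (z + 1) n * (of_real (real (Suc n) / real n) *
             exp (z * of_real (ln (real (Suc n)) - ln (real n)))) = ?f z (Suc n)"
        using eventually_gt_at_top[of 0]
      proof eventually_elim
        case (elim n)
        have "exp (of_real (ln (real n))) = (of_nat n :: complex)"
          using elim by (simp add: exp_of_real)
        then show ?case using elim
          by (simp add: exp_add exp_diff algebra_simps add_ac field_simps)
      qed
      ultimately show "(\<lambda>n. ?f z (Suc n)) \<longlonglongrightarrow> 1"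
        using Lim_transform_eventually by fastforce
    qed
  qed
  moreover obtain m :: nat where "- Re z < real m" using reals_Archimedean2 by blast
  then have "Re (z + of_nat m) > 0" by simp
  ultimately show ?thesis by blast
qed

subsection \<open>Gauss's theorem and the expansion at 1\<close>

theorem hyp_reg_Gauss:
  assumes A: "norm a \<le> A" "norm b \<le> A" and c: "Re c \<ge> 6 * A\<^sup>2 + 6 * A + 1"
  shows "hyp_reg a b c 1 = Gamma (c - a - b) * rGamma (c - a) * rGamma (c - b)"
proof -
  have A0: "A \<ge> 0" using A(1) norm_ge_zero order_trans by blast
  have re: "Re a \<le> A" "Re b \<le> A" using A complex_Re_le_cmod order_trans by blast+
  have nz: "rGamma (z + of_nat n) \<noteq> 0" if "Re z > 0" for z :: complex and n
    using that by (auto simp: rGamma_eq_zero_iff elim!: nonpos_Ints_cases dest!: arg_cong[of _ _ Re])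
  have "0 \<le> A\<^sup>2" by simp
  then have pos: "Re c > 0" "Re (c - a) > 0" "Re (c - b) > 0" "Re (c - a - b) > 0"
    using c re A0 by (simp_all only: minus_complex.sel; linarith)+
  \<comment> \<open>\<open>Q n\<close> is the quotient of the two sides of Gauss's formula at
    \<open>c + n\<close>. The contiguous relation makes it constant in \<open>n\<close>, and its
    limit is 1.\<close>
  define Q where "Q n = hyp_reg a b (c + of_nat n) 1 * rGamma (c - a - b + of_nat n) /
      (rGamma (c - a + of_nat n) * rGamma (c - b + of_nat n))" for n :: nat
  have "Q (Suc n) = Q n" for n
  proof -
    have cn: "Re (c + of_nat n) \<ge> 6 * A\<^sup>2 + 6 * A + 1" using c by simp
    have step: "rGamma (z + of_nat n) = (z + of_nat n) * rGamma (z + of_nat (Suc n))" for z :: complex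
      using rGamma_plus1[of "z + of_nat n"] by (simp add: add_ac)
    have ne: "c - a + of_nat n \<noteq> 0" "c - b + of_nat n \<noteq> 0"
      using nz[OF pos(2), of n] nz[OF pos(3), of n] by auto
    have E: "(c - a - b + of_nat n) * hyp_reg a b (c + of_nat n) 1
        = (c - a + of_nat n) * (c - b + of_nat n) * hyp_reg a b (c + of_nat (Suc n)) 1"
      using hyp_reg_1_contiguous[OF A cn] by (simp add: algebra_simps)
    have M: "hyp_reg a b (c + of_nat n) 1 * ((c - a - b + of_nat n) * R)
        = (c - a + of_nat n) * (c - b + of_nat n) * (hyp_reg a b (c + of_nat (Suc n)) 1 * R)" for R
    proof -
      have "hyp_reg a b (c + of_nat n) 1 * ((c - a - b + of_nat n) * R)
          = ((c - a - b + of_nat n) * hyp_reg a b (c + of_nat n) 1) * R" by (simp only: mult_ac)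
      then show ?thesis by (simp only: E mult.assoc)
    qed
    have "Q n = ((c - a + of_nat n) * (c - b + of_nat n)) * (hyp_reg a b (c + of_nat (Suc n)) 1 *
          rGamma (c - a - b + of_nat (Suc n))) / (((c - a + of_nat n) * (c - b + of_nat n)) *
          (rGamma (c - a + of_nat (Suc n)) * rGamma (c - b + of_nat (Suc n))))"
      unfolding Q_def step[of "c - a"] step[of "c - b"] step[of "c - a - b"] M by (simp only: mult_ac)
    then show ?thesis using ne by (simp only: Q_def mult_divide_mult_cancel_left mult_eq_0_iff simp_thms)
  qed
  then have Q0: "Q n = Q 0" for n by (induction n) auto
  let ?f = "\<lambda>z n. rGamma (z + of_nat (Suc n)) * fact n * exp (z * of_real (ln (of_nat n)))"
  \<comment> \<open>The exponentials cancel because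
    \<open>c + (c - a - b) = (c - a) + (c - b)\<close>, so the quotient of the four Gamma values
    tends to 1.\<close>
  have "(\<lambda>n. ?f c n * ?f (c - a - b) n / (?f (c - a) n * ?f (c - b) n)) \<longlonglongrightarrow> 1 * 1 / (1 * 1)"
    by (intro tendsto_divide tendsto_mult rGamma_asymptotic) auto
  moreover have "?f c n * ?f (c - a - b) n / (?f (c - a) n * ?f (c - b) n) =
     rGamma (c + of_nat (Suc n)) * rGamma (c - a - b + of_nat (Suc n)) /
      (rGamma (c - a + of_nat (Suc n)) * rGamma (c - b + of_nat (Suc n)))" for n
  proof -
    let ?l = "of_real (ln (of_nat n)) :: complex"
    have "exp (c * ?l) * exp ((c - a - b) * ?l) = exp ((c - a) * ?l) * exp ((c - b) * ?l)"
      by (simp add: exp_add [symmetric] algebra_simps)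
    moreover have "?f c n * ?f (c - a - b) n = (fact n * fact n * (exp (c * ?l) * exp ((c - a - b) * ?l))) *
        (rGamma (c + of_nat (Suc n)) * rGamma (c - a - b + of_nat (Suc n)))"
      by (simp only: mult_ac)
    moreover have "?f (c - a) n * ?f (c - b) n = (fact n * fact n * (exp ((c - a) * ?l) * exp ((c - b) * ?l))) *
        (rGamma (c - a + of_nat (Suc n)) * rGamma (c - b + of_nat (Suc n)))"
      by (simp only: mult_ac)
    moreover have "fact n * fact n * (exp ((c - a) * ?l) * exp ((c - b) * ?l)) \<noteq> 0" by simp
    ultimately show ?thesis by (simp only: mult_divide_mult_cancel_left simp_thms if_False)
  qed
  ultimately have lim1: "(\<lambda>n. rGamma (c + of_nat (Suc n)) * rGamma (c - a - b + of_nat (Suc n)) /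
      (rGamma (c - a + of_nat (Suc n)) * rGamma (c - b + of_nat (Suc n)))) \<longlonglongrightarrow> 1"
    by simp
  \<comment> \<open>The series at \<open>c + n + 1\<close> divided by its first term tends to 1,
    with error of order \<open>1 / n\<close>.\<close>
  have "(\<lambda>n. hyp_reg a b (c + of_nat (Suc n)) 1 / rGamma (c + of_nat (Suc n)) - 1) \<longlonglongrightarrow> 0"
  proof (rule Lim_null_comparison)
    show "(\<lambda>n. 3 * A\<^sup>2 / (Re c + real (Suc n))) \<longlonglongrightarrow> 0" by real_asymp
    have "norm (hyp_reg a b (c + of_nat (Suc n)) 1 / rGamma (c + of_nat (Suc n)) - 1)
          \<le> 3 * A\<^sup>2 / (Re c + real (Suc n))" for n
    proof -
      let ?c = "c + of_nat (Suc n)"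
      have "Re ?c \<ge> 6 * A\<^sup>2 + 6 * A + 1" using c by simp
      from hyp_coeff_sum_bounds(3)[OF A this]
      have "norm (hyp_reg a b ?c 1 - rGamma ?c) \<le> norm (rGamma ?c) * (3 * A\<^sup>2 / (Re c + real (Suc n)))"
        by (simp add: hyp_reg_altdef)
      moreover have "hyp_reg a b ?c 1 / rGamma ?c - 1 = (hyp_reg a b ?c 1 - rGamma ?c) / rGamma ?c"
        using nz[OF pos(1), of "Suc n"] by (simp add: field_simps del: of_nat_Suc)
      ultimately show ?thesis
        using nz[OF pos(1), of "Suc n"]
        by (simp add: norm_divide pos_divide_le_eq mult_ac del: of_nat_Suc)
    qed
    then show "\<forall>\<^sub>F n in sequentially. norm (hyp_reg a b (c + of_nat (Suc n)) 1 / rGamma (c + of_nat (Suc n)) - 1)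
          \<le> 3 * A\<^sup>2 / (Re c + real (Suc n))"
      by (intro always_eventually allI)
  qed
  then have "(\<lambda>n. hyp_reg a b (c + of_nat (Suc n)) 1 / rGamma (c + of_nat (Suc n))) \<longlonglongrightarrow> 1"
    by (simp add: LIM_zero_iff)
  from tendsto_mult[OF this lim1]
  have "(\<lambda>n. Q (Suc n)) \<longlonglongrightarrow> 1"
    using nz[OF pos(1)] unfolding Q_def by (simp del: of_nat_Suc)
  then have "(\<lambda>n::nat. Q 0) \<longlonglongrightarrow> 1" by (simp only: Q0[of "Suc _"])
  then have "Q 0 = 1" by (simp add: LIMSEQ_const_iff)
  then have "hyp_reg a b c 1 * rGamma (c - a - b) = rGamma (c - a) * rGamma (c - b)"
    using nz[OF pos(2), of 0] nz[OF pos(3), of 0] by (simp add: Q_def field_simps)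
  then show ?thesis
    using nz[OF pos(4), of 0] by (simp add: rGamma_inverse_Gamma field_simps)
qed

text \<open>Induction on \<open>k\<close>: the remainders obey
  \<open>R(k+1, M+1) = R(k, M+1) - y R(k, M)\<close>, and by Pascal's rule the bounds add up in the
  same way.\<close>

lemma binomial_truncation_bound:
  fixes y :: real
  assumes "0 \<le> y" "y \<le> 1"
  shows "\<bar>(1 - y) ^ k - (\<Sum>n<N. of_nat (k choose n) * (-y) ^ n)\<bar> \<le> of_nat (k choose N) * y ^ N"
proof (induction k arbitrary: N)
  case 0
  show ?case by (cases N) (auto simp: lessThan_Suc_eq_insert_0 sum.atLeast1_atMost_eq zero_notin_Suc_image sum.reindex)
next
  case (Suc k)
  show ?case
  proof (cases N)
    case 0
    then show ?thesis using assms power_le_one[of "1 - y" "Suc k"] by simp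
  next
    case (Suc M)
    let ?R = "\<lambda>k N. (1 - y) ^ k - (\<Sum>n<N. of_nat (k choose n) * (-y) ^ n)"
    have "(\<Sum>n<Suc M. of_nat (Suc k choose n) * (-y) ^ n) =
          (\<Sum>n<Suc M. of_nat (k choose n) * (-y) ^ n) - y * (\<Sum>n<M. of_nat (k choose n) * (-y) ^ n)"
      by (simp add: sum.lessThan_Suc_shift sum_distrib_left sum_subtractf sum.distrib sum_negf algebra_simps del: sum.lessThan_Suc)
    then have "?R (Suc k) (Suc M) = ?R k (Suc M) - y * ?R k M"
      by (simp add: algebra_simps del: sum.lessThan_Suc)
    also have "\<bar>\<dots>\<bar> \<le> \<bar>?R k (Suc M)\<bar> + y * \<bar>?R k M\<bar>"
      using abs_triangle_ineq4[of "?R k (Suc M)" "y * ?R k M"] assms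
      by (simp only: abs_mult abs_of_nonneg)
    also have "\<dots> \<le> of_nat (k choose Suc M) * y ^ Suc M + y * (of_nat (k choose M) * y ^ M)"
      using assms by (intro add_mono mult_left_mono Suc.IH) auto
    finally show ?thesis using Suc by (simp add: algebra_simps)
  qed
qed

text \<open>The terms with \<open>k < n\<close> vanish, so \<open>hyp_coeff_shift\<close> reindexes
  the sum to a value at 1 with parameters shifted by \<open>n\<close>, ready for Gauss's
  theorem.\<close>

lemma sums_binomial_hyp_coeff:
  assumes "summable (hyp_coeff (a + of_nat n) (b + of_nat n) (c + of_nat n))"
  shows "(\<lambda>k. of_nat (k choose n) * hyp_coeff a b c k) sums
           (pochhammer a n * pochhammer b n / fact n *
            hyp_reg (a + of_nat n) (b + of_nat n) (c + of_nat n) 1)"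
proof -
  have "(\<lambda>k. of_nat (k + n choose n) * hyp_coeff a b c (k + n)) sums
           (pochhammer a n * pochhammer b n / fact n *
            hyp_reg (a + of_nat n) (b + of_nat n) (c + of_nat n) 1)"
    unfolding hyp_coeff_shift using summable_sums[OF assms]
    by (intro sums_mult) (simp add: hyp_reg_altdef)
  moreover have "(\<Sum>i<n. of_nat (i choose n) * hyp_coeff a b c i) = 0"
    by (intro sum.neutral) (auto simp: binomial_eq_0)
  ultimately show ?thesis by (subst (asm) sums_iff_shift) simp
qed

text \<open>Truncating the binomial expansion of every \<open>(1 - y) ^ k\<close> at the same
  \<open>N\<close> leaves one Gauss sum for each power of \<open>y\<close>, so no two infinite sums
  are interchanged. The error is controlled by the absolute series with parameters shifted by
  \<open>N\<close>, for which \<open>A\<close> leaves room.\<close>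

theorem hyp_reg_expansion_at_1:
  fixes y :: real
  assumes A: "norm a + of_nat N \<le> A" "norm b + of_nat N \<le> A"
    and c: "Re c \<ge> 6 * A\<^sup>2 + 6 * A + 1" and y: "0 \<le> y" "y \<le> 1"
  shows "norm (hyp_reg a b c (of_real (1 - y)) -
            (\<Sum>n<N. pochhammer a n * pochhammer b n / fact n * Gamma (c - a - b - of_nat n) * of_real (-y) ^ n)
              * (rGamma (c - a) * rGamma (c - b)))
         \<le> 3 * norm (pochhammer a N * pochhammer b N) / fact N
            * norm (Gamma (c - a - b - of_nat N) * rGamma (c - a) * rGamma (c - b)) * y ^ N"
proof -
  let ?t = "hyp_coeff a b c"
  have An: "norm (a + of_nat n) \<le> A" "norm (b + of_nat n) \<le> A" if "n \<le> N" for n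
    using that A norm_triangle_ineq[of a "of_nat n"] norm_triangle_ineq[of b "of_nat n"]
    by (simp_all add: order_trans)
  have cn: "Re (c + of_nat n) \<ge> 6 * A\<^sup>2 + 6 * A + 1" for n using c by simp
  have A0: "A \<ge> 0" using An(1)[of 0] norm_ge_zero order_trans by blast
  have sumn: "summable (\<lambda>k. norm (hyp_coeff (a + of_nat n) (b + of_nat n) (c + of_nat n) k))" if "n \<le> N" for n
    using that by (intro hyp_coeff_sum_bounds(1)[OF An cn])
  have gauss: "hyp_reg (a + of_nat n) (b + of_nat n) (c + of_nat n) 1
      = Gamma (c - a - b - of_nat n) * rGamma (c - a) * rGamma (c - b)" if "n \<le> N" for n
    using hyp_reg_Gauss[OF An cn, of n n n] that by (simp add: algebra_simps)
  let ?p = "\<lambda>n. pochhammer a n * pochhammer b n / fact n"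
  have s1: "(\<lambda>k. of_nat (k choose n) * ?t k) sums (?p n * (Gamma (c - a - b - of_nat n) * rGamma (c - a) * rGamma (c - b)))"
    if "n \<le> N" for n
    using sums_binomial_hyp_coeff[OF summable_norm_cancel[OF sumn[OF that]]] gauss[OF that] by simp
  let ?S = "(\<Sum>n<N. ?p n * Gamma (c - a - b - of_nat n) * of_real (-y) ^ n) * (rGamma (c - a) * rGamma (c - b))"
  have "(\<lambda>k. \<Sum>n<N. of_real (-y) ^ n * (of_nat (k choose n) * ?t k)) sums
      (\<Sum>n<N. of_real (-y) ^ n * (?p n * (Gamma (c - a - b - of_nat n) * rGamma (c - a) * rGamma (c - b))))"
    by (intro sums_sum sums_mult s1) auto
  also have "(\<Sum>n<N. of_real (-y) ^ n * (?p n * (Gamma (c - a - b - of_nat n) * rGamma (c - a) * rGamma (c - b)))) = ?S"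
    by (simp add: sum_distrib_left sum_distrib_right mult_ac)
  finally have s2: "(\<lambda>k. \<Sum>n<N. of_real (-y) ^ n * (of_nat (k choose n) * ?t k)) sums ?S" .
  have "summable (\<lambda>k. norm (?t k))" using sumn[of 0] by simp
  then have "summable (\<lambda>k. norm (?t k * of_real (1 - y) ^ k))"
  proof (rule summable_comparison_test'[of _ 0])
    fix k show "norm (norm (?t k * of_real (1 - y) ^ k)) \<le> norm (?t k)"
      using y mult_left_le[of "(1 - y) ^ k" "norm (?t k)"]
      by (simp add: norm_mult norm_power power_le_one del: of_real_diff)
  qed
  then have s0: "(\<lambda>k. ?t k * of_real (1 - y) ^ k) sums hyp_reg a b c (of_real (1 - y))"
    unfolding hyp_reg_altdef by (rule summable_sums[OF summable_norm_cancel])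
  have eq: "?t k * of_real (1 - y) ^ k - (\<Sum>n<N. of_real (-y) ^ n * (of_nat (k choose n) * ?t k))
      = ?t k * of_real ((1 - y) ^ k - (\<Sum>n<N. of_nat (k choose n) * (-y) ^ n))" for k
    by (simp add: sum_distrib_left right_diff_distrib mult_ac)
  have s3: "(\<lambda>k. ?t k * of_real ((1 - y) ^ k - (\<Sum>n<N. of_nat (k choose n) * (-y) ^ n))) sums
      (hyp_reg a b c (of_real (1 - y)) - ?S)"
    using sums_diff[OF s0 s2] by (simp only: eq)
  let ?K = "norm (?p N)"
  have s4: "(\<lambda>k. norm (of_nat (k choose N) * ?t k)) sums
      (?K * (\<Sum>k. norm (hyp_coeff (a + of_nat N) (b + of_nat N) (c + of_nat N) k)))"
  proof -
    have "(\<lambda>k. norm (of_nat (k + N choose N) * ?t (k + N))) sums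
      (?K * (\<Sum>k. norm (hyp_coeff (a + of_nat N) (b + of_nat N) (c + of_nat N) k)))"
      unfolding hyp_coeff_shift norm_mult[of "?p N"] by (intro sums_mult summable_sums sumn) simp
    moreover have "(\<Sum>i<N. norm (of_nat (i choose N) * ?t i)) = 0"
      by (intro sum.neutral) (auto simp: binomial_eq_0)
    ultimately show ?thesis by (subst (asm) sums_iff_shift) simp
  qed
  let ?r = "\<lambda>k. norm (of_nat (k choose N) * ?t k) * y ^ N"
  note s5 = sums_mult2[OF s4, of "y ^ N"]
  have le: "norm (?t k * of_real ((1 - y) ^ k - (\<Sum>n<N. of_nat (k choose n) * (-y) ^ n))) \<le> ?r k" for k
  proof -
    have "norm (?t k * of_real ((1 - y) ^ k - (\<Sum>n<N. of_nat (k choose n) * (-y) ^ n)))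
        = norm (?t k) * \<bar>(1 - y) ^ k - (\<Sum>n<N. of_nat (k choose n) * (-y) ^ n)\<bar>"
      by (simp only: norm_mult norm_of_real)
    also have "\<dots> \<le> norm (?t k) * (of_nat (k choose N) * y ^ N)"
      by (intro mult_left_mono binomial_truncation_bound y) auto
    finally show ?thesis by (simp add: norm_mult mult_ac)
  qed
  have "norm (hyp_reg a b c (of_real (1 - y)) - ?S) \<le> (\<Sum>k. ?r k)"
    using norm_suminf_le[OF le sums_summable[OF s5]] sums_unique[OF s3] by simp
  also have "\<dots> = ?K * (\<Sum>k. norm (hyp_coeff (a + of_nat N) (b + of_nat N) (c + of_nat N) k)) * y ^ N"
    using sums_unique[OF s5] by simp
  also have "\<dots> \<le> ?K * (3 / 2 * norm (rGamma (c + of_nat N))) * y ^ N"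
    using y by (intro mult_right_mono mult_left_mono hyp_coeff_sum_bounds(2)[OF An cn]) auto
  \<comment> \<open>The first term of the shifted series is at most twice its sum, which Gauss's
    theorem evaluates. As the shift preserves \<open>c - a\<close> and \<open>c - b\<close>, the
    error acquires the Gamma factors of the first omitted term.\<close>
  also have "\<dots> \<le> ?K * (3 / 2 * (2 * norm (Gamma (c - a - b - of_nat N) * rGamma (c - a) * rGamma (c - b)))) * y ^ N"
  proof -
    let ?h = "hyp_reg (a + of_nat N) (b + of_nat N) (c + of_nat N) 1" and ?c = "c + of_nat N"
    have "0 \<le> A\<^sup>2" by simp
    then have pos: "Re ?c > 0" using cn[of N] A0 by linarith
    have "3 * A\<^sup>2 / Re ?c \<le> 1 / 2" using cn[of N] A0 pos by (simp add: pos_divide_le_eq)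
    then have "norm (rGamma ?c) * (3 * A\<^sup>2 / Re ?c) \<le> norm (rGamma ?c) * (1 / 2)"
      by (intro mult_left_mono) auto
    then have "norm (?h - rGamma ?c) \<le> norm (rGamma ?c) / 2"
      using hyp_coeff_sum_bounds(3)[OF An[of N] cn[of N]] by (simp add: hyp_reg_altdef)
    then have "norm (rGamma ?c) \<le> 2 * norm ?h"
      using norm_triangle_ineq2[of "rGamma ?c" ?h] by (simp add: norm_minus_commute)
    then show ?thesis unfolding gauss[OF order_refl] using y
      by (intro mult_right_mono mult_left_mono) auto
  qed
  finally show ?thesis by (simp add: norm_divide mult_ac)
qed

subsection \<open>Differential equation and singular behaviour at 1\<close>

lemma summable_norm_hyp_coeff_power:
  assumes "norm w < 1"
  shows "summable (\<lambda>k. norm (hyp_coeff a b c k * w ^ k))"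
proof -
  have lim: "(\<lambda>k. (z + of_nat k) / of_nat (Suc k)) \<longlonglongrightarrow> 1" for z :: complex
  proof -
    have "(\<lambda>k. 1 + (z - 1) * (1 / of_nat (Suc k))) \<longlonglongrightarrow> 1 + (z - 1) * 0"
      by (intro tendsto_intros LIMSEQ_Suc[OF lim_1_over_n])
    moreover have "1 + (z - 1) * (1 / of_nat (Suc k)) = (z + of_nat k) / of_nat (Suc k)" for k
      using of_nat_neq_0[of k, where 'a = complex] by (simp add: divide_simps)
    ultimately show ?thesis by simp
  qed
  have "(\<lambda>k. norm ((a + of_nat k) / of_nat (Suc k) * ((b + of_nat k) / of_nat (Suc k)) /
           ((c + of_nat k) / of_nat (Suc k))) * norm w) \<longlonglongrightarrow> norm (1 * 1 / 1 :: complex) * norm w"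
    by (intro tendsto_intros lim) auto
  moreover define \<rho> where "\<rho> = (1 + norm w) / 2"
  have "norm w < \<rho>" "\<rho> < 1" using assms by (simp_all add: \<rho>_def)
  ultimately have "\<forall>\<^sub>F k in sequentially. norm ((a + of_nat k) / of_nat (Suc k) * ((b + of_nat k) / of_nat (Suc k)) /
           ((c + of_nat k) / of_nat (Suc k))) * norm w < \<rho>"
    by (intro order_tendstoD) auto
  \<comment> \<open>If \<open>c\<close> is a nonpositive integer, the recurrence can be solved for
    the next coefficient only from some index on.\<close>
  moreover obtain K where "- Re c < real K" using reals_Archimedean2 by blast
  then have "\<forall>\<^sub>F k in sequentially. c + of_nat k \<noteq> 0"
    unfolding eventually_sequentially by (intro exI[of _ K]) (auto dest!: arg_cong[of _ _ Re])
  ultimately have "\<forall>\<^sub>F k in sequentially. norm (norm (hyp_coeff a b c (Suc k) * w ^ Suc k))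
      \<le> \<rho> * norm (norm (hyp_coeff a b c k * w ^ k))"
  proof eventually_elim
    case (elim k)
    let ?q = "(a + of_nat k) / of_nat (Suc k) * ((b + of_nat k) / of_nat (Suc k)) /
           ((c + of_nat k) / of_nat (Suc k))"
    have "of_nat (Suc k) \<noteq> (0 :: complex)" by (rule of_nat_neq_0)
    then have "hyp_coeff a b c (Suc k) = ?q * hyp_coeff a b c k"
      using hyp_coeff_Suc[of c k a b] elim(2)
      by (simp add: divide_simps mult_ac del: of_nat_Suc)
    then have "norm (hyp_coeff a b c (Suc k) * w ^ Suc k) = (norm ?q * norm w) * norm (hyp_coeff a b c k * w ^ k)"
      by (simp only: norm_mult power_Suc mult_ac)
    also have "\<dots> \<le> \<rho> * norm (hyp_coeff a b c k * w ^ k)"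
      using elim(1) by (intro mult_right_mono) auto
    finally show ?case by simp
  qed
  then obtain M where "\<And>k. k \<ge> M \<Longrightarrow> norm (norm (hyp_coeff a b c (Suc k) * w ^ Suc k))
      \<le> \<rho> * norm (norm (hyp_coeff a b c k * w ^ k))"
    unfolding eventually_sequentially by blast
  with \<open>\<rho> < 1\<close> show ?thesis by (rule summable_ratio_test)
qed

lemma hyp_reg_sums:
  "norm w < 1 \<Longrightarrow> (\<lambda>k. hyp_coeff a b c k * w ^ k) sums hyp_reg a b c w"
  unfolding hyp_reg_altdef
  by (rule summable_sums[OF summable_norm_cancel[OF summable_norm_hyp_coeff_power]])

lemma hyp_reg_0 [simp]: "hyp_reg a b c 0 = rGamma c"
  using hyp_reg_sums[of 0 a b c] powser_sums_zero_iff[of "hyp_coeff a b c"] by simp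

lemma has_field_derivative_hyp_reg:
  assumes "norm w < 1"
  shows "(hyp_reg a b c has_field_derivative a * b * hyp_reg (a + 1) (b + 1) (c + 1) w) (at w)"
proof -
  define K where "K = complex_of_real ((1 + norm w) / 2)"
  have K: "norm w < norm K" "norm K < 1" using assms by (auto simp: K_def norm_of_real simp del: of_real_divide)
  have "((\<lambda>w. \<Sum>k. hyp_coeff a b c k * w ^ k) has_field_derivative
           (\<Sum>k. diffs (hyp_coeff a b c) k * w ^ k)) (at w)"
    by (rule termdiffs_strong[OF sums_summable[OF hyp_reg_sums[OF K(2)]] K(1)])
  moreover have "(\<Sum>k. diffs (hyp_coeff a b c) k * w ^ k) = a * b * hyp_reg (a + 1) (b + 1) (c + 1) w"
    unfolding diffs_def hyp_coeff_shift_1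
    using sums_mult[OF hyp_reg_sums[OF assms], of "a * b" "a + 1" "b + 1" "c + 1"]
    by (simp add: sums_iff mult.assoc)
  ultimately show ?thesis unfolding hyp_reg_altdef[abs_def] by simp
qed

text \<open>Continuity up to the boundary circle permits evaluating Wronskians by limits at both
  endpoints 0 and 1.\<close>

lemma continuous_on_hyp_reg_cball:
  assumes "summable (\<lambda>k. norm (hyp_coeff a b c k))"
  shows "continuous_on (cball 0 1) (hyp_reg a b c)"
proof -
  have "uniform_limit (cball 0 1) (\<lambda>n w. \<Sum>k<n. hyp_coeff a b c k * w ^ k) (hyp_reg a b c) sequentially"
    unfolding hyp_reg_altdef[abs_def]
  proof (rule Weierstrass_m_test[OF _ assms])
    fix k and w :: complex assume "w \<in> cball 0 1"
    then have "norm w ^ k \<le> 1" by (simp add: power_le_one)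
    then show "norm (hyp_coeff a b c k * w ^ k) \<le> norm (hyp_coeff a b c k)"
      by (simp add: norm_mult norm_power mult_left_le)
  qed
  then show ?thesis
    by (rule uniform_limit_theorem[rotated]) (auto intro!: always_eventually continuous_intros)
qed

text \<open>\<open>D\<close> and \<open>E\<close> are the first two derivatives at \<open>w\<close>,
  by \<open>has_field_derivative_hyp_reg\<close>. Once multiplication by \<open>w\<close> is read as
  an index shift, comparing coefficients leaves exactly \<open>hyp_coeff_Suc\<close>.\<close>

lemma hyp_reg_ODE:
  fixes a b c w :: complex
  defines "D \<equiv> a * b * hyp_reg (a + 1) (b + 1) (c + 1) w"
    and "E \<equiv> a * b * ((a + 1) * (b + 1) * hyp_reg (a + 1 + 1) (b + 1 + 1) (c + 1 + 1) w)"
  assumes w: "norm w < 1"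
  shows "w * (1 - w) * E + (c - (a + b + 1) * w) * D = a * b * hyp_reg a b c w"
proof -
  let ?t = "hyp_coeff a b c"
  have S0: "(\<lambda>k. ?t k * w ^ k) sums hyp_reg a b c w" by (rule hyp_reg_sums[OF w])
  have S1: "(\<lambda>k. of_nat (Suc k) * ?t (Suc k) * w ^ k) sums D"
    unfolding hyp_coeff_shift_1 D_def using sums_mult[OF hyp_reg_sums[OF w], of "a * b"]
    by (simp add: mult.assoc)
  have "(\<lambda>k. a * b * (of_nat (Suc k) * hyp_coeff (a + 1) (b + 1) (c + 1) (Suc k)) * w ^ k) sums E"
    unfolding hyp_coeff_shift_1[of _ "a + 1"] E_def
    using sums_mult[OF hyp_reg_sums[OF w], of "a * b * ((a + 1) * (b + 1))"]
    by (simp add: mult.assoc)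
  moreover have "a * b * (of_nat (Suc k) * hyp_coeff (a + 1) (b + 1) (c + 1) (Suc k))
      = of_nat (Suc k) * (of_nat (Suc (Suc k)) * ?t (Suc (Suc k)))" for k
    by (simp only: hyp_coeff_shift_1[of "Suc k" a b c] mult_ac)
  ultimately have S2: "(\<lambda>k. of_nat (Suc k) * (of_nat (Suc (Suc k)) * ?t (Suc (Suc k))) * w ^ k) sums E"
    by (simp only:)
  have shift: "g sums (w * s)" if "f sums s" "\<And>k. g (Suc k) = w * f k" "g 0 = 0" for f g s
    using sums_Suc[of g "w * s"] sums_mult[OF that(1), of w] by (simp add: that(2,3))
  have wD: "(\<lambda>k. of_nat k * ?t k * w ^ k) sums (w * D)"
    by (rule shift[OF S1]) auto
  have wE: "(\<lambda>k. of_nat k * (of_nat (Suc k) * ?t (Suc k)) * w ^ k) sums (w * E)"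
    by (rule shift[OF S2]) auto
  have wwE: "(\<lambda>k. of_nat k * (of_nat k - 1) * ?t k * w ^ k) sums (w * (w * E))"
    by (rule shift[OF wE]) (auto simp: mult_ac)
  have "(\<lambda>k. of_nat k * (of_nat (Suc k) * ?t (Suc k)) * w ^ k + c * (of_nat (Suc k) * ?t (Suc k) * w ^ k))
      sums (w * E + c * D)"
    by (intro sums_add sums_mult wE S1)
  moreover have "(\<lambda>k. a * b * (?t k * w ^ k) + (a + b + 1) * (of_nat k * ?t k * w ^ k) +
        of_nat k * (of_nat k - 1) * ?t k * w ^ k)
      sums (a * b * hyp_reg a b c w + (a + b + 1) * (w * D) + w * (w * E))"
    by (intro sums_add sums_mult S0 wD wwE)
  moreover have "of_nat k * (of_nat (Suc k) * ?t (Suc k)) * w ^ k + c * (of_nat (Suc k) * ?t (Suc k) * w ^ k)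
      = a * b * (?t k * w ^ k) + (a + b + 1) * (of_nat k * ?t k * w ^ k) +
        of_nat k * (of_nat k - 1) * ?t k * w ^ k" for k
  proof -
    have "of_nat k * (of_nat (Suc k) * ?t (Suc k)) * w ^ k + c * (of_nat (Suc k) * ?t (Suc k) * w ^ k)
      = ((c + of_nat k) * of_nat (Suc k) * ?t (Suc k)) * w ^ k"
      by (simp add: algebra_simps)
    also have "\<dots> = (a + of_nat k) * (b + of_nat k) * ?t k * w ^ k"
      by (simp only: hyp_coeff_Suc)
    finally show ?thesis by (simp add: algebra_simps)
  qed
  ultimately have "w * E + c * D = a * b * hyp_reg a b c w + (a + b + 1) * (w * D) + w * (w * E)"
    by (simp add: sums_unique2)
  then show ?thesis by (simp add: algebra_simps)
qed

section \<open>Binomial series as comparison near the singular point 1\<close>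

lemma binomial_series_real:
  fixes m x :: real
  assumes "0 < x" "x \<le> 1"
  shows "(\<lambda>k. pochhammer m k / fact k * (1 - x) ^ k) sums (x powr (-m))"
proof -
  have "(\<lambda>k. ((-m) gchoose k) * (x - 1) ^ k) sums (x powr (-m))"
    using gen_binomial_real[of "x - 1" "-m"] assms by simp
  moreover have "((-m) gchoose k) * (x - 1) ^ k = pochhammer m k / fact k * (1 - x) ^ k" for k
  proof -
    have "(x - 1) ^ k = (-1) ^ k * (1 - x) ^ k" by (simp flip: power_mult_distrib)
    then show ?thesis by (simp add: gbinomial_pochhammer flip: power_mult_distrib)
  qed
  ultimately show ?thesis by simp
qed

lemma binomial_series_complex:
  fixes d :: complex and x :: real
  assumes "0 < x" "x \<le> 1"
  shows "(\<lambda>k. pochhammer d k / fact k * of_real (1 - x) ^ k) sums (of_real x powr (-d))"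
proof -
  have "norm (complex_of_real (x - 1)) < 1" using assms by (simp add: norm_of_real del: of_real_diff)
  from gen_binomial_complex[OF this, of "-d"]
  have "(\<lambda>k. ((-d) gchoose k) * of_real (x - 1) ^ k) sums (of_real x powr (-d))" by simp
  moreover have "((-d) gchoose k) * of_real (x - 1) ^ k = pochhammer d k / fact k * of_real (1 - x) ^ k" for k
  proof -
    have "complex_of_real (x - 1) ^ k = (-1) ^ k * of_real (1 - x) ^ k" by (simp flip: power_mult_distrib)
    then show ?thesis by (simp add: gbinomial_pochhammer flip: power_mult_distrib)
  qed
  ultimately show ?thesis by simp
qed

text \<open>Coefficients small relative to those of \<open>x powr (-m)\<close> give a sum small
  relative to \<open>x powr (-m)\<close>. After multiplication by \<open>x powr m\<close> the terms
  from \<open>K\<close> on contribute at most \<open>\<epsilon> / 2\<close>, and the finitely many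
  earlier ones tend to 0.\<close>

lemma abelian_binomial:
  fixes e :: "nat \<Rightarrow> complex" and m :: real
  assumes m: "m > 0" and e: "e \<longlonglongrightarrow> 0"
  shows "((\<lambda>x. of_real (x powr m) * (\<Sum>k. e k * of_real (pochhammer m k / fact k * (1 - x) ^ k))) \<longlongrightarrow> 0) (at_right 0)"
proof (rule tendstoI)
  fix \<epsilon> :: real assume \<epsilon>: "\<epsilon> > 0"
  obtain K where K: "\<And>k. k \<ge> K \<Longrightarrow> norm (e k) < \<epsilon> / 2"
    using e \<epsilon> by (metis LIMSEQ_iff diff_zero half_gt_zero)
  let ?Q = "\<lambda>k. pochhammer m k / fact k"
  have Q: "?Q k \<ge> 0" for k using m by (simp add: pochhammer_nonneg)
  define C where "C = (\<Sum>k<K. norm (e k) * ?Q k)"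
  have "((\<lambda>x::real. x powr m * C) \<longlongrightarrow> 0 * C) (at_right 0)"
    by (intro tendsto_mult tendsto_const) (use m in real_asymp)
  then have "\<forall>\<^sub>F x in at_right 0. x powr m * C < \<epsilon> / 2"
    using \<epsilon> by (intro order_tendstoD) auto
  moreover have "\<forall>\<^sub>F x in at_right (0::real). 0 < x \<and> x < 1"
    unfolding eventually_at_right_field by (intro exI[of _ 1]) auto
  ultimately show "\<forall>\<^sub>F x in at_right 0. dist (of_real (x powr m) * (\<Sum>k. e k * of_real (?Q k * (1 - x) ^ k))) 0 < \<epsilon>"
  proof eventually_elim
    case (elim x)
    let ?r = "\<lambda>k. (if k \<in> {..<K} then norm (e k) * ?Q k else 0) + \<epsilon> / 2 * (?Q k * (1 - x) ^ k)"
    have s: "?r sums (C + \<epsilon> / 2 * x powr (-m))"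
      unfolding C_def using elim by (intro sums_add sums_If_finite_set sums_mult binomial_series_real) auto
    have le: "norm (e k * of_real (?Q k * (1 - x) ^ k)) \<le> ?r k" for k
    proof -
      have p: "0 \<le> (1 - x) ^ k" "(1 - x) ^ k \<le> 1" using elim by (auto intro: power_le_one)
      have 1: "norm (e k * of_real (?Q k * (1 - x) ^ k)) = norm (e k) * (?Q k * (1 - x) ^ k)"
        using p Q[of k] by (simp only: norm_mult norm_of_real abs_of_nonneg mult_nonneg_nonneg)
      show ?thesis
      proof (cases "k < K")
        case True
        have "norm (e k) * (?Q k * (1 - x) ^ k) \<le> norm (e k) * (?Q k * 1)"
          using p Q by (intro mult_left_mono) auto
        moreover have "\<epsilon> / 2 * (?Q k * (1 - x) ^ k) \<ge> 0"
          using p \<epsilon> Q by (intro mult_nonneg_nonneg) auto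
        ultimately show ?thesis using True 1 by simp
      next
        case False
        then have "norm (e k) * (?Q k * (1 - x) ^ k) \<le> \<epsilon> / 2 * (?Q k * (1 - x) ^ k)"
          using K[of k] p Q by (intro mult_right_mono mult_nonneg_nonneg) auto
        then show ?thesis using 1 False by simp
      qed
    qed
    have "norm (\<Sum>k. e k * of_real (?Q k * (1 - x) ^ k)) \<le> C + \<epsilon> / 2 * x powr (-m)"
      using norm_suminf_le[OF le sums_summable[OF s]] sums_unique[OF s] by simp
    then have "x powr m * norm (\<Sum>k. e k * of_real (?Q k * (1 - x) ^ k)) \<le> x powr m * (C + \<epsilon> / 2 * x powr (-m))"
      by (intro mult_left_mono) auto
    also have "\<dots> = x powr m * C + \<epsilon> / 2"
      using elim by (simp add: algebra_simps powr_minus)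
    finally show ?case using elim by (simp add: norm_mult)
  qed
qed

text \<open>Because \<open>a + b = c + d\<close>, the quotient of the coefficients by those of
  \<open>x powr (-d)\<close> tends to \<open>L\<close>. Subtracting \<open>L * x powr (-d)\<close>
  therefore leaves a sum covered by \<open>abelian_binomial\<close>.\<close>

lemma hyp_reg_singular_behaviour_at_1:
  assumes abcd: "a + b = c + d" and d: "Re d > 0"
  shows "((\<lambda>x. of_real x powr d * hyp_reg a b c (of_real (1 - x))) \<longlongrightarrow> rGamma a * rGamma b * Gamma d) (at_right 0)"
proof -
  define m where "m = Re d"
  define L where "L = rGamma a * rGamma b * Gamma d"
  let ?q = "\<lambda>k. pochhammer d k / fact k" and ?Q = "\<lambda>k. pochhammer m k / fact k"
  have m: "m > 0" using d by (simp add: m_def)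
  have dn: "rGamma d \<noteq> 0" using d by (auto simp: rGamma_eq_zero_iff elim!: nonpos_Ints_cases)
  have mn: "rGamma m \<noteq> 0" using m by (auto simp: rGamma_eq_zero_iff elim!: nonpos_Ints_cases)
  have pd: "pochhammer d k \<noteq> 0" for k using dn pochhammer_rGamma[of d k] by auto
  have pm: "pochhammer m k \<noteq> 0" for k using mn pochhammer_rGamma[of m k] by auto
  \<comment> \<open>The error is measured against the binomial coefficients of the real exponent
    \<open>m = Re d\<close>, for which \<open>abelian_binomial\<close> is stated.\<close>
  define e where "e k = (hyp_coeff a b c k - L * ?q k) / of_real (?Q k)" for k
  have "e \<longlonglongrightarrow> 0"
  proof (rule LIMSEQ_imp_Suc)
    let ?f = "\<lambda>z n. rGamma (z + of_nat (Suc n)) * fact n * exp (z * of_real (ln (of_nat n))) :: complex"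
    have "(\<lambda>n. rGamma_series a n * rGamma_series b n * ?f c n / rGamma_series d n - L) \<longlonglongrightarrow>
        rGamma a * rGamma b * 1 / rGamma d - L"
      by (intro tendsto_intros rGamma_asymptotic dn)
    moreover have "rGamma a * rGamma b * 1 / rGamma d - L = 0"
      by (simp add: L_def rGamma_inverse_Gamma divide_simps)
    moreover have "rGamma_series a n * rGamma_series b n * ?f c n / rGamma_series d n
        = hyp_coeff a b c (Suc n) / ?q (Suc n)" for n
    proof -
      let ?l = "of_real (ln (of_nat n)) :: complex"
      have "exp (a * ?l) * exp (b * ?l) = exp (c * ?l) * exp (d * ?l)"
        by (simp add: exp_add [symmetric] abcd flip: distrib_right)
      then have "exp (c * ?l) = exp (a * ?l) * exp (b * ?l) / exp (d * ?l)" by (simp add: field_simps)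
      then show ?thesis using pd[of "Suc n"]
        by (simp add: rGamma_series_def hyp_coeff_def field_simps del: of_nat_Suc fact_Suc)
    qed
    ultimately have "(\<lambda>n. hyp_coeff a b c (Suc n) / ?q (Suc n) - L) \<longlonglongrightarrow> 0" by simp
    \<comment> \<open>Complex and real binomial coefficients have comparable size, because
      \<open>norm (n powr d) = n powr m\<close>.\<close>
    moreover have "Bseq (\<lambda>n. ?q (Suc n) / of_real (?Q (Suc n)))"
    proof -
      have "(\<lambda>n. norm (rGamma_series d n) / norm (rGamma_series m n)) \<longlonglongrightarrow> norm (rGamma d) / norm (rGamma m)"
        using mn by (intro tendsto_intros) auto
      moreover have "norm (rGamma_series d n) / norm (rGamma_series m n) = norm (?q (Suc n) / of_real (?Q (Suc n)))" for n
        by (simp add: rGamma_series_def norm_divide norm_mult m_def field_simps del: of_nat_Suc fact_Suc)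
      ultimately have "convergent (\<lambda>n. norm (?q (Suc n) / of_real (?Q (Suc n))))"
        by (auto simp: convergent_def)
      then have "Bseq (\<lambda>n. norm (?q (Suc n) / of_real (?Q (Suc n))))" by (rule convergent_imp_Bseq)
      then show ?thesis by (simp only: Bseq_def real_norm_def abs_norm_cancel)
    qed
    ultimately have "Zfun (\<lambda>n. (hyp_coeff a b c (Suc n) / ?q (Suc n) - L) * (?q (Suc n) / of_real (?Q (Suc n)))) sequentially"
      by (intro bounded_bilinear.Zfun_prod_Bfun[OF bounded_bilinear_mult]) (simp_all add: tendsto_Zfun_iff)
    moreover have "(hyp_coeff a b c (Suc n) / ?q (Suc n) - L) * (?q (Suc n) / of_real (?Q (Suc n))) = e (Suc n)" for n
    proof -
      have aux: "(h / q - L) * (q / r) = (h - L * q) / r" if "q \<noteq> 0" for h q r :: complex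
        using that by (cases "r = 0") (simp_all add: field_simps)
      show ?thesis unfolding e_def by (rule aux) (use pd[of "Suc n"] in \<open>simp del: fact_Suc\<close>)
    qed
    ultimately show "(\<lambda>n. e (Suc n)) \<longlonglongrightarrow> 0" by (simp only: tendsto_Zfun_iff diff_zero)
  qed
  from abelian_binomial[OF m this]
  have lim: "((\<lambda>x. of_real (x powr m) * (\<Sum>k. e k * of_real (?Q k * (1 - x) ^ k))) \<longlongrightarrow> 0) (at_right 0)" .
  have ev: "\<forall>\<^sub>F x in at_right (0::real). 0 < x \<and> x < 1"
    unfolding eventually_at_right_field by (intro exI[of _ 1]) auto
  have "((\<lambda>x. of_real x powr d * hyp_reg a b c (of_real (1 - x)) - L) \<longlongrightarrow> 0) (at_right 0)"
  proof (rule Lim_null_comparison[OF _ tendsto_norm_zero[OF lim]])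
    show "\<forall>\<^sub>F x in at_right 0. norm (of_real x powr d * hyp_reg a b c (of_real (1 - x)) - L)
        \<le> norm (of_real (x powr m) * (\<Sum>k. e k * of_real (?Q k * (1 - x) ^ k)))"
      using ev
    proof eventually_elim
      case (elim x)
      have n1: "norm (complex_of_real (1 - x)) < 1" using elim by (simp add: norm_of_real del: of_real_diff)
      have "(\<lambda>k. hyp_coeff a b c k * of_real (1 - x) ^ k - L * (?q k * of_real (1 - x) ^ k)) sums
          (hyp_reg a b c (of_real (1 - x)) - L * of_real x powr (-d))"
        using elim by (intro sums_diff sums_mult hyp_reg_sums n1 binomial_series_complex) auto
      moreover have "hyp_coeff a b c k * of_real (1 - x) ^ k - L * (?q k * of_real (1 - x) ^ k)
          = e k * of_real (?Q k * (1 - x) ^ k)" for k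
      proof -
        have aux: "h * y - L * (q * y) = (h - L * q) / Q * (Q * y)" if "Q \<noteq> 0" for h q Q y :: complex
        proof -
          have "(h - L * q) / Q * (Q * y) = ((h - L * q) / Q * Q) * y" by (simp only: mult.assoc)
          also have "\<dots> = (h - L * q) * y" using that by simp
          finally show ?thesis by (simp add: left_diff_distrib)
        qed
        have "complex_of_real (?Q k) \<noteq> 0" using pm[of k] by simp
        then show ?thesis unfolding e_def of_real_mult of_real_power by (rule aux)
      qed
      ultimately have eq: "(\<Sum>k. e k * of_real (?Q k * (1 - x) ^ k)) = hyp_reg a b c (of_real (1 - x)) - L * of_real x powr (-d)"
        by (simp add: sums_iff)
      have p: "of_real x powr d * of_real x powr (-d) = (1 :: complex)"
        using elim by (simp add: powr_minus)
      then have "of_real x powr d * hyp_reg a b c (of_real (1 - x)) - L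
          = of_real x powr d * (hyp_reg a b c (of_real (1 - x)) - L * of_real x powr (-d))"
        by (simp only: right_diff_distrib mult.left_commute[of _ L] mult_1_right)
      then show ?case unfolding eq using elim
        by (simp only: norm_mult) (simp add: norm_powr_real_powr m_def)
    qed
  qed
  then show ?thesis unfolding L_def by (rule LIM_zero_cancel)
qed

subsection \<open>Legendre's equation\<close>

text \<open>The lens where the series in \<open>w\<close> and in \<open>1 - w\<close> both converge.
  It is convex, invariant under replacing \<open>w\<close> by \<open>1 - w\<close>, and contains the
  real open interval from 0 to 1.\<close>

definition legendre_domain :: "complex set" where
  "legendre_domain = ball 0 1 \<inter> ball 1 1"

text \<open>The power \<open>((1 - w) / w) powr (\<mu> / 2)\<close> on the lens, which for
  \<open>w = (1 - x) / 2\<close> is the prefactor of the Ferrers function. The difference of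
  logarithms gives the derivative and the reflection rule directly.\<close>

definition legendre_factor :: "complex \<Rightarrow> complex \<Rightarrow> complex" where
  "legendre_factor \<mu> w = exp (\<mu> / 2 * (Ln (1 - w) - Ln w))"

text \<open>Legendre's equation in \<open>w = (1-x)/2\<close> as a first-order system: \<open>u'\<close> stands for the quasi-derivative
  \<open>w(1-w) du/dw\<close>, so that the Wronskian \<open>u v' - u' v\<close> is constant.\<close>

definition legendre_solution ::
  "complex \<Rightarrow> complex \<Rightarrow> (complex \<Rightarrow> complex) \<Rightarrow> (complex \<Rightarrow> complex) \<Rightarrow> bool" where
  "legendre_solution \<nu> \<mu> u u' \<longleftrightarrow> (\<forall>w\<in>legendre_domain.
     (u has_field_derivative u' w / (w * (1 - w))) (at w) \<and>
     (u' has_field_derivative (\<mu>\<^sup>2 / (4 * (w * (1 - w))) - \<nu> * (\<nu> + 1)) * u w) (at w))"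

lemma legendre_domainD:
  assumes "w \<in> legendre_domain"
  shows "norm w < 1" "norm (1 - w) < 1" "Re w > 0" "Re (1 - w) > 0" "w \<noteq> 0" "1 - w \<noteq> 0" "w * (1 - w) \<noteq> 0"
    "w \<notin> \<real>\<^sub>\<le>\<^sub>0" "1 - w \<notin> \<real>\<^sub>\<le>\<^sub>0" "1 - w \<in> legendre_domain"
proof -
  show n: "norm w < 1" "norm (1 - w) < 1"
    using assms by (auto simp: legendre_domain_def dist_norm)
  show re: "Re w > 0" "Re (1 - w) > 0"
    using n complex_Re_le_cmod[of w] complex_Re_le_cmod[of "1 - w"] by auto
  show nz: "w \<noteq> 0" "1 - w \<noteq> 0" using re by (auto simp del: minus_complex.sel right_minus_eq)
  then show "w * (1 - w) \<noteq> 0" by simp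
  show "w \<notin> \<real>\<^sub>\<le>\<^sub>0" "1 - w \<notin> \<real>\<^sub>\<le>\<^sub>0" using re by (auto simp: complex_nonpos_Reals_iff)
  show "1 - w \<in> legendre_domain" using n by (simp add: legendre_domain_def dist_norm norm_minus_commute)
qed

lemma of_real_in_legendre_domain:
  "0 < x \<Longrightarrow> x < 1 \<Longrightarrow> complex_of_real x \<in> legendre_domain"
  using norm_of_real[of "1 - x", where 'a = complex] by (simp add: legendre_domain_def dist_norm norm_of_real)

lemma legendre_factor_mult: "legendre_factor \<mu> w * legendre_factor (-\<mu>) w = 1"
  by (simp add: legendre_factor_def flip: exp_add)

lemma legendre_factor_reflect: "legendre_factor (-\<mu>) (1 - w) = legendre_factor \<mu> w"
  by (simp add: legendre_factor_def algebra_simps)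

lemma has_field_derivative_legendre_factor:
  assumes "w \<in> legendre_domain"
  shows "(legendre_factor \<mu> has_field_derivative - (\<mu> / (2 * (w * (1 - w)))) * legendre_factor \<mu> w) (at w)"
proof -
  note D = legendre_domainD[OF assms]
  have "- (1 / (1 - w)) - 1 / w = - (1 / w + 1 / (1 - w))" by simp
  also have "1 / w + 1 / (1 - w) = 1 / (w * (1 - w))"
    using add_frac_eq[of w "1 - w" 1 1] D(5,6) by simp
  finally have eq: "- (1 / (1 - w)) - 1 / w = - (1 / (w * (1 - w)))" .
  have r: "((\<lambda>w. 1 - w) has_field_derivative (-1)) (at w)"
    by (auto intro!: derivative_eq_intros)
  have "((\<lambda>w. Ln (1 - w) - Ln w) has_field_derivative - (1 / (1 - w)) - 1 / w) (at w)"
    using DERIV_diff[OF DERIV_chain2[OF has_field_derivative_Ln[OF D(9)] r] has_field_derivative_Ln[OF D(8)]]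
    by (simp add: divide_inverse)
  from DERIV_chain2[OF DERIV_exp DERIV_cmult[OF this, of "\<mu> / 2"]]
  show ?thesis unfolding eq legendre_factor_def[abs_def] by (simp add: mult_ac)
qed

text \<open>Stripping off \<open>legendre_factor\<close> turns Legendre's equation into the
  hypergeometric one. Replacing \<open>\<mu>\<close> by \<open>-\<mu>\<close> yields another
  solution of the same equation, which contains only \<open>\<mu>\<^sup>2\<close>.\<close>

lemma legendre_solution_hyp_reg:
  fixes \<nu> \<mu> :: complex
  defines "F' \<equiv> \<lambda>w. (\<nu> + 1) * (-\<nu>) * hyp_reg (\<nu> + 1 + 1) (-\<nu> + 1) (1 - \<mu> + 1) w"
    and "F \<equiv> hyp_reg (\<nu> + 1) (-\<nu>) (1 - \<mu>)"
  shows "legendre_solution \<nu> \<mu> (\<lambda>w. legendre_factor \<mu> w * F w)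
           (\<lambda>w. legendre_factor \<mu> w * (w * (1 - w) * F' w - \<mu> / 2 * F w))"
  unfolding legendre_solution_def
proof (intro ballI conjI)
  fix w assume w: "w \<in> legendre_domain"
  note D = legendre_domainD[OF w]
  define r where "r = legendre_factor \<mu> w"
  define E where "E = (\<nu> + 1) * (-\<nu>) * ((\<nu> + 1 + 1) * (-\<nu> + 1) *
    hyp_reg (\<nu> + 1 + 1 + 1) (-\<nu> + 1 + 1) (1 - \<mu> + 1 + 1) w)"
  define p where "p = w * (1 - w)"
  have p: "p \<noteq> 0" using D by (simp add: p_def)
  note dr = has_field_derivative_legendre_factor[OF w, of \<mu>, folded p_def r_def]
  have dF: "(F has_field_derivative F' w) (at w)"
    unfolding F_def F'_def by (rule has_field_derivative_hyp_reg[OF D(1)])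
  have dF': "(F' has_field_derivative E) (at w)"
    unfolding F'_def E_def by (intro DERIV_cmult has_field_derivative_hyp_reg[OF D(1)])
  have dp: "((\<lambda>w. w * (1 - w)) has_field_derivative 1 - 2 * w) (at w)"
    by (auto intro!: derivative_eq_intros)
  \<comment> \<open>Here \<open>a + b + 1 = 2\<close> and \<open>c = 1 - \<mu>\<close>;
    \<open>F'\<close> and \<open>E\<close> are the first two derivatives of
    \<open>F\<close>.\<close>
  have ode: "p * E + (1 - \<mu> - 2 * w) * F' w = - (\<nu> * (\<nu> + 1)) * F w"
    using hyp_reg_ODE[OF D(1), of "\<nu> + 1" "-\<nu>" "1 - \<mu>"]
    unfolding E_def F'_def F_def p_def by (simp add: algebra_simps)
  have "r * F' w + - (\<mu> / (2 * p)) * r * F w = r * (p * F' w - \<mu> / 2 * F w) / p"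
    using p by (simp add: field_simps)
  with DERIV_mult[OF dr dF]
  show "((\<lambda>w. legendre_factor \<mu> w * F w) has_field_derivative
         legendre_factor \<mu> w * (w * (1 - w) * F' w - \<mu> / 2 * F w) / (w * (1 - w))) (at w)"
    by (simp add: p_def r_def mult_ac add.commute)
  have d1: "((\<lambda>w. w * (1 - w) * F' w - \<mu> / 2 * F w) has_field_derivative
       p * E + (1 - 2 * w) * F' w - \<mu> / 2 * F' w) (at w)"
    using DERIV_diff[OF DERIV_mult[OF dp dF'] DERIV_cmult[OF dF, of "\<mu> / 2"]]
    by (simp add: p_def mult_ac add_ac)
  have "- (\<mu> / (2 * p)) * r * (p * F' w - \<mu> / 2 * F w) + (p * E + (1 - 2 * w) * F' w - \<mu> / 2 * F' w) * r
      = r * ((p * E + (1 - \<mu> - 2 * w) * F' w) + \<mu>\<^sup>2 / (4 * p) * F w)"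
    using p by (simp add: field_simps power2_eq_square)
  also have "\<dots> = (\<mu>\<^sup>2 / (4 * p) - \<nu> * (\<nu> + 1)) * (r * F w)"
    unfolding ode by (simp add: algebra_simps)
  finally show "((\<lambda>w. legendre_factor \<mu> w * (w * (1 - w) * F' w - \<mu> / 2 * F w)) has_field_derivative
     (\<mu>\<^sup>2 / (4 * (w * (1 - w))) - \<nu> * (\<nu> + 1)) * (legendre_factor \<mu> w * F w)) (at w)"
    using DERIV_mult[OF dr d1] by (simp add: p_def r_def)
qed

text \<open>The coefficients depend on \<open>w\<close> only through \<open>w * (1 - w)\<close>,
  while the chain rule reverses the sign of the quasi-derivative.\<close>

lemma legendre_solution_reflect:
  assumes "legendre_solution \<nu> \<mu> u u'"
  shows "legendre_solution \<nu> \<mu> (\<lambda>w. u (1 - w)) (\<lambda>w. - u' (1 - w))"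
  unfolding legendre_solution_def
proof (intro ballI conjI)
  fix w assume "w \<in> legendre_domain"
  then have "1 - w \<in> legendre_domain" by (rule legendre_domainD)
  with assms have d: "(u has_field_derivative u' (1 - w) / (w * (1 - w))) (at (1 - w))"
    "(u' has_field_derivative (\<mu>\<^sup>2 / (4 * (w * (1 - w))) - \<nu> * (\<nu> + 1)) * u (1 - w)) (at (1 - w))"
    unfolding legendre_solution_def by (auto simp: mult_ac)
  have r: "((\<lambda>w. 1 - w) has_field_derivative (-1)) (at w)"
    by (auto intro!: derivative_eq_intros)
  from DERIV_chain2[OF d(1) r]
  show "((\<lambda>w. u (1 - w)) has_field_derivative - u' (1 - w) / (w * (1 - w))) (at w)" by simp
  from DERIV_minus[OF DERIV_chain2[OF d(2) r]]
  show "((\<lambda>w. - u' (1 - w)) has_field_derivative (\<mu>\<^sup>2 / (4 * (w * (1 - w))) - \<nu> * (\<nu> + 1)) * u (1 - w)) (at w)"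
    by simp
qed

lemma legendre_wronskian_constant:
  assumes "legendre_solution \<nu> \<mu> u u'" "legendre_solution \<nu> \<mu> v v'"
  shows "\<exists>k. \<forall>w\<in>legendre_domain. u w * v' w - u' w * v w = k"
proof (rule has_field_derivative_zero_constant)
  show "convex legendre_domain" unfolding legendre_domain_def by (intro convex_Int convex_ball)
  fix w assume w: "w \<in> legendre_domain"
  let ?q = "\<mu>\<^sup>2 / (4 * (w * (1 - w))) - \<nu> * (\<nu> + 1)"
  have d: "(u has_field_derivative u' w / (w * (1 - w))) (at w)" "(u' has_field_derivative ?q * u w) (at w)"
    "(v has_field_derivative v' w / (w * (1 - w))) (at w)" "(v' has_field_derivative ?q * v w) (at w)"
    using assms w unfolding legendre_solution_def by auto
  have "((\<lambda>w. u w * v' w - u' w * v w) has_field_derivative 0) (at w)"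
    using DERIV_diff[OF DERIV_mult[OF d(1,4)] DERIV_mult[OF d(2,3)]] by (simp add: mult_ac)
  then show "((\<lambda>w. u w * v' w - u' w * v w) has_field_derivative 0) (at w within legendre_domain)"
    by (rule has_field_derivative_at_within)
qed

text \<open>Used to evaluate a constant Wronskian at the singular points 0 and 1, which lie outside
  the lens but are limits of its real points.\<close>

lemma constant_on_legendre_domain_limits:
  fixes f :: "complex \<Rightarrow> complex"
  assumes "\<forall>w\<in>legendre_domain. f w = k"
  shows "((\<lambda>x. f (of_real x)) \<longlongrightarrow> l) (at_right 0) \<Longrightarrow> k = l"
    and "((\<lambda>x. f (of_real (1 - x))) \<longlongrightarrow> l) (at_right 0) \<Longrightarrow> k = l"
proof -
  have ev: "\<forall>\<^sub>F x in at_right (0::real). 0 < x \<and> x < 1"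
    unfolding eventually_at_right_field by (intro exI[of _ 1]) auto
  have nb: "at_right (0::real) \<noteq> bot" by simp
  have transfer: "k = l" if "\<forall>\<^sub>F x in at_right 0. F x = k" "(F \<longlongrightarrow> l) (at_right 0)" for F :: "real \<Rightarrow> complex"
    using Lim_transform_eventually[OF that(2,1)] by (simp add: tendsto_const_iff[OF nb])
  show "k = l" if "((\<lambda>x. f (of_real x)) \<longlongrightarrow> l) (at_right 0)"
    by (rule transfer[OF _ that], rule eventually_mono[OF ev])
       (intro bspec[OF assms] of_real_in_legendre_domain; simp)
  show "k = l" if "((\<lambda>x. f (of_real (1 - x))) \<longlongrightarrow> l) (at_right 0)"
    by (rule transfer[OF _ that], rule eventually_mono[OF ev])
       (intro bspec[OF assms] of_real_in_legendre_domain; simp)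
qed

subsection \<open>The connection formula\<close>

theorem hyp_reg_connection:
  fixes \<nu> \<mu> :: complex and x :: real
  assumes A: "norm \<nu> + 2 \<le> A" and \<mu>: "Re \<mu> \<ge> 6 * A\<^sup>2 + 6 * A + 1" and x: "0 < x" "x < 1"
  defines "\<Phi> \<equiv> hyp_reg (\<nu> + 1) (-\<nu>) (1 + \<mu>)" and "H \<equiv> hyp_reg (\<nu> + 1) (-\<nu>) (1 - \<mu>)"
  shows "rGamma (\<mu> - \<nu>) * rGamma (\<mu> + \<nu> + 1) * (legendre_factor \<mu> (of_real x) * H (of_real x))
       = sin (of_real pi * \<mu>) / of_real pi * (legendre_factor \<mu> (of_real x) * \<Phi> (of_real (1 - x)))
         - sin (of_real pi * \<nu>) / of_real pi * (legendre_factor (-\<mu>) (of_real x) * \<Phi> (of_real x))"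
proof -
  define \<Phi>' where "\<Phi>' = (\<lambda>w. (\<nu> + 1) * (-\<nu>) * hyp_reg (\<nu> + 1 + 1) (-\<nu> + 1) (1 + \<mu> + 1) w)"
  define H' where "H' = (\<lambda>w. (\<nu> + 1) * (-\<nu>) * hyp_reg (\<nu> + 1 + 1) (-\<nu> + 1) (1 - \<mu> + 1) w)"
  have A0: "A \<ge> 0" using A norm_ge_zero[of \<nu>] by linarith
  have \<mu>0: "Re \<mu> > 0" using \<mu> A0 zero_le_power2[of A] by linarith
  have bounds: "norm (\<nu> + 1) \<le> A" "norm (-\<nu>) \<le> A" "norm (\<nu> + 1 + 1) \<le> A" "norm (-\<nu> + 1) \<le> A"
    using A norm_triangle_ineq[of \<nu> 1] norm_triangle_ineq[of \<nu> 2] norm_triangle_ineq[of "-\<nu>" 1]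
    by (simp_all add: add.assoc)
  have c: "Re (1 + \<mu>) \<ge> 6 * A\<^sup>2 + 6 * A + 1" "Re (1 + \<mu> + 1) \<ge> 6 * A\<^sup>2 + 6 * A + 1"
    using \<mu> by simp_all
  have cont: "continuous_on (cball 0 1) \<Phi>" "continuous_on (cball 0 1) \<Phi>'"
    unfolding \<Phi>_def \<Phi>'_def
    by (intro continuous_on_mult_left continuous_on_hyp_reg_cball
          hyp_coeff_sum_bounds(1)[OF bounds(1,2) c(1)] hyp_coeff_sum_bounds(1)[OF bounds(3,4) c(2)])+
  have contH: "isCont H 0" "isCont H' 0"
    unfolding H_def H'_def
    by (intro isCont_mult continuous_const DERIV_isCont[OF has_field_derivative_hyp_reg]; simp)+
  have ev: "\<forall>\<^sub>F x in at_right (0::real). 0 < x \<and> x < 1"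
    unfolding eventually_at_right_field by (intro exI[of _ 1]) auto
  have lim_x: "((\<lambda>x. complex_of_real x) \<longlongrightarrow> 0) (at_right 0)"
    using tendsto_of_real[OF tendsto_ident_at, where 'a = complex] by (metis of_real_0)
  have lim_1x: "((\<lambda>x. complex_of_real (1 - x)) \<longlongrightarrow> 1) (at_right 0)"
    using tendsto_diff[OF tendsto_const[of 1] lim_x] by simp
  have lim0: "((\<lambda>x. f (of_real x)) \<longlongrightarrow> f 0) (at_right 0)" if "continuous_on (cball 0 1) f" for f :: "complex \<Rightarrow> complex"
    by (rule continuous_on_tendsto_compose[OF that lim_x])
       (use ev in \<open>auto elim!: eventually_mono\<close>)
  have lim1: "((\<lambda>x. f (of_real (1 - x))) \<longlongrightarrow> f 1) (at_right 0)" if "continuous_on (cball 0 1) f" for f :: "complex \<Rightarrow> complex"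
    by (rule continuous_on_tendsto_compose[OF that lim_1x])
       (use ev in \<open>auto elim!: eventually_mono simp del: of_real_diff\<close>)
  note lims = lim0[OF cont(1)] lim0[OF cont(2)] lim1[OF cont(1)] lim1[OF cont(2)]
    isCont_tendsto_compose[OF contH(1) lim_x] isCont_tendsto_compose[OF contH(2) lim_x] lim_x lim_1x
  define r where "r = legendre_factor \<mu>"
  define s where "s = legendre_factor (-\<mu>)"
  have rs: "r w * s w = 1" for w by (simp add: r_def s_def legendre_factor_mult)
  \<comment> \<open>\<open>f\<close> is the solution that is small at 0, \<open>g\<close> is its
    reflection, small at 1, and \<open>h\<close> is the Ferrers function of the first kind in the
    variable \<open>w\<close>.\<close>
  define f where "f = (\<lambda>w. s w * \<Phi> w)"
  define f' where "f' = (\<lambda>w. s w * (w * (1 - w) * \<Phi>' w + \<mu> / 2 * \<Phi> w))"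
  define g where "g = (\<lambda>w. r w * \<Phi> (1 - w))"
  define g' where "g' = (\<lambda>w. - (r w * (w * (1 - w) * \<Phi>' (1 - w) + \<mu> / 2 * \<Phi> (1 - w))))"
  define h where "h = (\<lambda>w. r w * H w)"
  define h' where "h' = (\<lambda>w. r w * (w * (1 - w) * H' w - \<mu> / 2 * H w))"
  have solf: "legendre_solution \<nu> \<mu> f f'"
    using legendre_solution_hyp_reg[of \<nu> "-\<mu>"]
    by (simp add: f_def f'_def s_def \<Phi>_def \<Phi>'_def legendre_solution_def)
  have "s (1 - w) = r w" for w by (simp add: r_def s_def legendre_factor_reflect)
  then have solg: "legendre_solution \<nu> \<mu> g g'"
    using legendre_solution_reflect[OF solf]
    by (simp add: f_def f'_def g_def g'_def mult_ac)
  have solh: "legendre_solution \<nu> \<mu> h h'"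
    using legendre_solution_hyp_reg[of \<nu> \<mu>]
    unfolding h_def h'_def r_def H_def H'_def .
  have rG: "\<mu> * rGamma (1 + \<mu>) = rGamma \<mu>" using rGamma_plus1[of \<mu>] by (simp add: add.commute)
  have rG0: "rGamma \<mu> \<noteq> 0" "rGamma (1 + \<mu>) \<noteq> 0" 
    using \<mu>0 by (auto simp: rGamma_eq_zero_iff elim!: nonpos_Ints_cases dest!: arg_cong[of _ _ Re])
  have \<Phi>1: "\<Phi> 1 = Gamma \<mu> * (rGamma (\<mu> - \<nu>) * rGamma (\<mu> + \<nu> + 1))"
    using hyp_reg_Gauss[OF bounds(1,2) c(1)] unfolding \<Phi>_def by (simp add: algebra_simps)
  obtain k1 where k1: "\<forall>w\<in>legendre_domain. f w * g' w - f' w * g w = k1"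
    using legendre_wronskian_constant[OF solf solg] by blast
  \<comment> \<open>The factors \<open>r\<close> and \<open>s\<close> cancel, and at 0 the
    derivative terms vanish with \<open>w\<close>. What survives is
    \<open>-\<mu> \<Phi>(0) \<Phi>(1)\<close>, with \<open>\<Phi>(1)\<close> known from Gauss's
    theorem.\<close>
  have "k1 = - (rGamma (\<mu> - \<nu>) * rGamma (\<mu> + \<nu> + 1))"
  proof -
    have "((\<lambda>x. - (\<Phi> (of_real x) * (of_real x * of_real (1 - x) * \<Phi>' (of_real (1 - x)) + \<mu> / 2 * \<Phi> (of_real (1 - x))) +
        (of_real x * of_real (1 - x) * \<Phi>' (of_real x) + \<mu> / 2 * \<Phi> (of_real x)) * \<Phi> (of_real (1 - x)))) \<longlongrightarrow>
        - (\<Phi> 0 * (0 * 1 * \<Phi>' 1 + \<mu> / 2 * \<Phi> 1) + (0 * 1 * \<Phi>' 0 + \<mu> / 2 * \<Phi> 0) * \<Phi> 1)) (at_right 0)"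
      by (rule tendsto_minus tendsto_add tendsto_mult lims tendsto_const)+
    moreover have "f w * g' w - f' w * g w = - (\<Phi> w * (w * (1 - w) * \<Phi>' (1 - w) + \<mu> / 2 * \<Phi> (1 - w)) +
        (w * (1 - w) * \<Phi>' w + \<mu> / 2 * \<Phi> w) * \<Phi> (1 - w))" for w
    proof -
      have "f w * g' w - f' w * g w = - ((r w * s w) * (\<Phi> w * (w * (1 - w) * \<Phi>' (1 - w) + \<mu> / 2 * \<Phi> (1 - w)) +
        (w * (1 - w) * \<Phi>' w + \<mu> / 2 * \<Phi> w) * \<Phi> (1 - w)))"
        unfolding f_def f'_def g_def g'_def by (simp add: algebra_simps)
      then show ?thesis by (simp add: rs)
    qed
    ultimately have "k1 = - (\<Phi> 0 * (0 * 1 * \<Phi>' 1 + \<mu> / 2 * \<Phi> 1) + (0 * 1 * \<Phi>' 0 + \<mu> / 2 * \<Phi> 0) * \<Phi> 1)"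
      by (intro constant_on_legendre_domain_limits(1)[OF k1]) simp
    also have "\<dots> = - (\<mu> * rGamma (1 + \<mu>) * \<Phi> 1)" by (simp add: \<Phi>_def)
    also have "\<dots> = - (rGamma (\<mu> - \<nu>) * rGamma (\<mu> + \<nu> + 1))"
      using rG0 unfolding rG \<Phi>1 by (simp add: rGamma_inverse_Gamma)
    finally show ?thesis .
  qed
  obtain k2 where k2: "\<forall>w\<in>legendre_domain. h w * f' w - h' w * f w = k2"
    using legendre_wronskian_constant[OF solh solf] by blast
  \<comment> \<open>This constant is also read off at 0; the limit
    \<open>rGamma (1 - \<mu>) * rGamma \<mu>\<close> is a sine by the reflection formula.\<close>
  have "k2 = sin (of_real pi * \<mu>) / of_real pi"
  proof -
    have "((\<lambda>x. H (of_real x) * (of_real x * of_real (1 - x) * \<Phi>' (of_real x) + \<mu> / 2 * \<Phi> (of_real x)) -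
        (of_real x * of_real (1 - x) * H' (of_real x) - \<mu> / 2 * H (of_real x)) * \<Phi> (of_real x)) \<longlongrightarrow>
        H 0 * (0 * 1 * \<Phi>' 0 + \<mu> / 2 * \<Phi> 0) - (0 * 1 * H' 0 - \<mu> / 2 * H 0) * \<Phi> 0) (at_right 0)"
      by (rule tendsto_diff tendsto_add tendsto_mult lims tendsto_const)+
    moreover have "h w * f' w - h' w * f w = H w * (w * (1 - w) * \<Phi>' w + \<mu> / 2 * \<Phi> w) -
        (w * (1 - w) * H' w - \<mu> / 2 * H w) * \<Phi> w" for w
    proof -
      have "h w * f' w - h' w * f w = (r w * s w) * (H w * (w * (1 - w) * \<Phi>' w + \<mu> / 2 * \<Phi> w) -
        (w * (1 - w) * H' w - \<mu> / 2 * H w) * \<Phi> w)"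
        unfolding f_def f'_def h_def h'_def by (simp add: algebra_simps)
      then show ?thesis by (simp add: rs)
    qed
    ultimately have "k2 = H 0 * (0 * 1 * \<Phi>' 0 + \<mu> / 2 * \<Phi> 0) - (0 * 1 * H' 0 - \<mu> / 2 * H 0) * \<Phi> 0"
      by (intro constant_on_legendre_domain_limits(1)[OF k2]) simp
    also have "\<dots> = rGamma (1 - \<mu>) * (\<mu> * rGamma (1 + \<mu>))" by (simp add: \<Phi>_def H_def)
    finally show ?thesis unfolding rG using rGamma_reflection_complex[of \<mu>] by (simp add: mult.commute)
  qed
  obtain k3 where k3: "\<forall>w\<in>legendre_domain. g w * h' w - g' w * h w = k3"
    using legendre_wronskian_constant[OF solg solh] by blast
  \<comment> \<open>This constant is read off at 1. With \<open>x = 1 - w\<close>, \<open>H\<close>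
    and \<open>H'\<close> grow at most like \<open>x powr (-\<mu>)\<close> and
    \<open>x powr (-\<mu> - 1)\<close>. The factor \<open>r\<^sup>2\<close> supplies
    \<open>x powr \<mu>\<close> and \<open>w * (1 - w)\<close> one more \<open>x\<close>, so
    \<open>H'\<close> leaves a finite limit and \<open>H\<close> drops out.\<close>
  have "k3 = - (sin (of_real pi * \<nu>) / of_real pi)"
  proof -
    have "((\<lambda>x. of_real x powr (\<mu> + 1) * hyp_reg (\<nu> + 1 + 1) (-\<nu> + 1) (1 - \<mu> + 1) (of_real (1 - x)))
        \<longlongrightarrow> rGamma (\<nu> + 1 + 1) * rGamma (-\<nu> + 1) * Gamma (\<mu> + 1)) (at_right 0)"
      using \<mu>0 by (intro hyp_reg_singular_behaviour_at_1) auto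
    from tendsto_mult[OF tendsto_const[of "(\<nu> + 1) * (-\<nu>)"] this]
    have l1: "((\<lambda>x. of_real x powr (\<mu> + 1) * H' (of_real (1 - x))) \<longlongrightarrow>
         (\<nu> + 1) * (-\<nu>) * (rGamma (\<nu> + 1 + 1) * rGamma (-\<nu> + 1) * Gamma (\<mu> + 1))) (at_right 0)"
      by (simp add: H'_def mult_ac)
    have "((\<lambda>x. of_real x powr \<mu> * H (of_real (1 - x))) \<longlongrightarrow> rGamma (\<nu> + 1) * rGamma (-\<nu>) * Gamma \<mu>) (at_right 0)"
      unfolding H_def using \<mu>0 by (intro hyp_reg_singular_behaviour_at_1) auto
    from tendsto_mult[OF lim_x this]
    have l2: "((\<lambda>x. of_real x * (of_real x powr \<mu> * H (of_real (1 - x)))) \<longlongrightarrow> 0) (at_right 0)" by simp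
    have "((\<lambda>x::real. ln (1 - x)) \<longlongrightarrow> 0) (at_right 0)" by real_asymp
    from tendsto_of_real[OF this]
    have l3: "((\<lambda>x. complex_of_real (ln (1 - x))) \<longlongrightarrow> 0) (at_right 0)" by simp
    have "((\<lambda>x. exp (- \<mu> * of_real (ln (1 - x))) * of_real (1 - x) *
         (\<Phi> (of_real x) * (of_real x powr (\<mu> + 1) * H' (of_real (1 - x))) +
          \<Phi>' (of_real x) * (of_real x * (of_real x powr \<mu> * H (of_real (1 - x)))))) \<longlongrightarrow>
        exp (- \<mu> * 0) * 1 * (\<Phi> 0 * ((\<nu> + 1) * (-\<nu>) * (rGamma (\<nu> + 1 + 1) * rGamma (-\<nu> + 1) * Gamma (\<mu> + 1)))
          + \<Phi>' 0 * 0)) (at_right 0)" (is "(?L \<longlongrightarrow> ?l) _")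
      by (rule tendsto_exp tendsto_add tendsto_mult lims tendsto_const l1 l2 l3)+
    moreover have "\<forall>\<^sub>F x in at_right 0. ?L x =
       g (of_real (1 - x)) * h' (of_real (1 - x)) - g' (of_real (1 - x)) * h (of_real (1 - x))"
      using ev
    proof eventually_elim
      case (elim x)
      have W: "g w * h' w - g' w * h w = r w * r w * (w * (1 - w) * (\<Phi> (1 - w) * H' w + \<Phi>' (1 - w) * H w))" for w
        unfolding g_def g'_def h_def h'_def by (simp add: algebra_simps)
      have rr: "r (of_real (1 - x)) * r (of_real (1 - x)) = exp (- \<mu> * of_real (ln (1 - x))) * of_real x powr \<mu>"
      proof -
        have "Ln (1 - of_real x) = of_real (ln (1 - x))" "Ln (of_real x) = of_real (ln x)"
          using elim Ln_of_real[of "1 - x"] Ln_of_real[of x] by auto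
        then show ?thesis using elim
          by (simp add: r_def legendre_factor_def powr_def algebra_simps flip: exp_add)
      qed
      have pw: "of_real x powr (\<mu> + 1) = of_real x powr \<mu> * complex_of_real x"
        using elim by (simp add: powr_add)
      show ?case unfolding W rr pw by (simp add: algebra_simps)
    qed
    ultimately have "((\<lambda>x. g (of_real (1 - x)) * h' (of_real (1 - x)) - g' (of_real (1 - x)) * h (of_real (1 - x)))
         \<longlongrightarrow> ?l) (at_right 0)"
      by (rule Lim_transform_eventually)
    then have "k3 = ?l" by (rule constant_on_legendre_domain_limits(2)[OF k3])
    \<comment> \<open>Absorbing \<open>\<nu> + 1\<close> and \<open>-\<nu>\<close> into the
      reciprocal Gamma functions lets the reflection formula apply for every
      \<open>\<nu>\<close>.\<close>
    also have "?l = rGamma (1 + \<mu>) * Gamma (1 + \<mu>) * (((\<nu> + 1) * rGamma (\<nu> + 1 + 1)) * ((-\<nu>) * rGamma (-\<nu> + 1)))"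
      by (simp add: \<Phi>_def algebra_simps)
    also have "\<dots> = rGamma (-\<nu>) * rGamma (1 - (-\<nu>))"
      using rG0(2) unfolding rGamma_plus1 by (simp add: rGamma_inverse_Gamma add_ac)
    also have "\<dots> = - (sin (of_real pi * \<nu>) / of_real pi)"
      by (simp only: rGamma_reflection_complex) simp
    finally show ?thesis .
  qed
  define w where "w = complex_of_real x"
  have w: "w \<in> legendre_domain" unfolding w_def by (rule of_real_in_legendre_domain[OF x])
  \<comment> \<open>Up to sign this is a 3 by 3 determinant with rows \<open>(f, g, h)\<close>,
    \<open>(f, g, h)\<close> and \<open>(f', g', h')\<close>, hence 0.\<close>
  have "h w * (f w * g' w - f' w * g w) + f w * (g w * h' w - g' w * h w) + g w * (h w * f' w - h' w * f w) = 0"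
    by (simp add: algebra_simps)
  then have "h w * k1 + f w * k3 + g w * k2 = 0" using k1 k2 k3 w by simp
  then show ?thesis
    unfolding \<open>k1 = _\<close> \<open>k2 = _\<close> \<open>k3 = _\<close> f_def g_def h_def r_def s_def w_def
    by (simp add: algebra_simps) 
qed

subsection \<open>Inverse factorial expansion\<close>

text \<open>The function \<open>G(\<mu>,y)\<close> of the overview. The Gamma factors cancel those
  produced by Gauss's theorem, so for large \<open>Re \<mu>\<close> the value at
  \<open>y = 0\<close> is \<open>Gamma \<mu>\<close>.\<close>

definition ferrers_core :: "complex \<Rightarrow> complex \<Rightarrow> real \<Rightarrow> complex" where
  "ferrers_core \<nu> \<mu> y = Gamma (\<mu> + \<nu> + 1) * Gamma (\<mu> - \<nu>) *
     hyp_reg (\<nu> + 1) (-\<nu>) (1 + \<mu>) (of_real (1 - y))"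

lemma Gamma_rGamma_cancel:
  "Re z > 0 \<Longrightarrow> Gamma z * rGamma z = (1 :: complex)"
proof -
  assume "Re z > 0"
  then have "rGamma z \<noteq> 0" by (auto simp: rGamma_eq_zero_iff elim!: nonpos_Ints_cases)
  then show ?thesis by (simp add: Gamma_def)
qed

text \<open>A difference of squares: each factor of the product splits as
  \<open>-4 * (\<nu> + 1 + n) * (-\<nu> + n)\<close>. The 4 leaves \<open>2 ^ n\<close> from the
  denominator \<open>8 ^ n\<close>, which accounts for powers of \<open>2 * y\<close> instead of
  \<open>y\<close>.\<close>

lemma a_coeff_pochhammer:
  "a_coeff n (\<nu> + 1/2) * 2 ^ n = (-1) ^ n * (pochhammer (\<nu> + 1) n * pochhammer (-\<nu>) n / fact n)"
proof -
  have "(\<Prod>k = 1..n. 4 * (\<nu> + 1/2)\<^sup>2 - (2 * of_nat k - 1)\<^sup>2)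
      = (-1) ^ n * 4 ^ n * (pochhammer (\<nu> + 1) n * pochhammer (-\<nu>) n)"
  proof (induction n)
    case (Suc n)
    have F: "4 * (\<nu> + 1/2)\<^sup>2 - (2 * of_nat (Suc n) - 1)\<^sup>2 = -1 * 4 * ((\<nu> + 1 + of_nat n) * (-\<nu> + of_nat n))"
      by (simp add: power2_eq_square field_simps)
    have "(\<Prod>k = 1..Suc n. 4 * (\<nu> + 1/2)\<^sup>2 - (2 * of_nat k - 1)\<^sup>2)
        = (\<Prod>k = 1..n. 4 * (\<nu> + 1/2)\<^sup>2 - (2 * of_nat k - 1)\<^sup>2) * (4 * (\<nu> + 1/2)\<^sup>2 - (2 * of_nat (Suc n) - 1)\<^sup>2)"
      by (simp add: prod.nat_ivl_Suc' mult.commute)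
    then show ?case unfolding F Suc.IH pochhammer_Suc power_Suc by (simp only: mult_ac)
  qed auto
  moreover have "(8 :: complex) ^ n = 4 ^ n * 2 ^ n" by (simp flip: power_mult_distrib)
  ultimately show ?thesis by (simp add: a_coeff_def field_simps)
qed

lemma norm_pochhammer_le:
  fixes z :: complex
  assumes "norm z + of_nat n \<le> A"
  shows "norm (pochhammer z n) \<le> A ^ n"
proof -
  have "norm (pochhammer z n) = (\<Prod>i<n. norm (z + of_nat i))"
    by (simp add: pochhammer_prod prod_norm atLeast0LessThan)
  also have "\<dots> \<le> (\<Prod>i<n. A)"
  proof (intro prod_mono conjI)
    fix i assume "i \<in> {..<n}"
    then show "norm (z + of_nat i) \<le> A"
      using assms norm_triangle_ineq[of z "of_nat i"] by simp
  qed auto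
  finally show ?thesis by simp
qed

text \<open>Multiplying \<open>hyp_reg_expansion_at_1\<close> by the two Gamma functions removes the
  reciprocal ones from the main terms and the error alike. The constant depends only on
  \<open>A\<close> and \<open>N\<close>, hence is uniform for bounded \<open>\<nu>\<close>.\<close>

theorem ferrers_core_expansion:
  assumes A: "norm \<nu> + 1 + of_nat N \<le> A" and \<mu>: "Re \<mu> \<ge> 6 * A\<^sup>2 + 6 * A + 1" and y: "0 \<le> y" "y \<le> 1"
  shows "norm (ferrers_core \<nu> \<mu> y -
           (\<Sum>n<N. a_coeff n (\<nu> + 1/2) * Gamma (\<mu> - of_nat n) * of_real (2 * y) ^ n))
         \<le> 3 * (A ^ N * A ^ N) * (norm (Gamma (\<mu> - of_nat N)) * (2 * y) ^ N)"
proof -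
  have A0: "A \<ge> 0" using A norm_ge_zero[of \<nu>] of_nat_0_le_iff[of N, where 'a = real] by linarith
  have pos: "Re (\<mu> - \<nu>) > 0" "Re (\<mu> + \<nu> + 1) > 0"
    using \<mu> A A0 complex_Re_le_cmod[of \<nu>] complex_Re_le_cmod[of "-\<nu>"] zero_le_power2[of A]
    unfolding plus_complex.sel minus_complex.sel one_complex.sel uminus_complex.sel norm_minus_cancel by linarith+
  define G where "G = Gamma (\<mu> + \<nu> + 1) * Gamma (\<mu> - \<nu>)"
  define r where "r = rGamma (\<mu> - \<nu>) * rGamma (\<mu> + \<nu> + 1)"
  have Gr: "G * r = 1"
    using Gamma_rGamma_cancel[OF pos(1)] Gamma_rGamma_cancel[OF pos(2)]
    unfolding G_def r_def by (simp add: mult_ac)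
  have b: "norm (\<nu> + 1) + of_nat N \<le> A" "norm (-\<nu>) + of_nat N \<le> A"
    using A norm_triangle_ineq[of \<nu> 1] by auto
  have c: "Re (1 + \<mu>) \<ge> 6 * A\<^sup>2 + 6 * A + 1" using \<mu> by simp
  let ?p = "\<lambda>n. pochhammer (\<nu> + 1) n * pochhammer (-\<nu>) n"
  let ?S = "\<Sum>n<N. ?p n / fact n * Gamma (\<mu> - of_nat n) * of_real (-y) ^ n"
  have e: "\<mu> - \<nu> - - \<nu> = \<mu>" "1 + \<mu> - (\<nu> + 1) = \<mu> - \<nu>" "1 + \<mu> - - \<nu> = \<mu> + \<nu> + 1"
    by simp_all
  have main: "norm (hyp_reg (\<nu> + 1) (-\<nu>) (1 + \<mu>) (of_real (1 - y)) - ?S * r)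
       \<le> 3 * norm (?p N) / fact N * norm (Gamma (\<mu> - of_nat N) * r) * y ^ N"
    using hyp_reg_expansion_at_1[OF b c y] unfolding e r_def by (simp only: mult.assoc)
  have S: "?S = (\<Sum>n<N. a_coeff n (\<nu> + 1/2) * Gamma (\<mu> - of_nat n) * of_real (2 * y) ^ n)"
  proof (intro sum.cong refl)
    fix n
    have "a_coeff n (\<nu> + 1/2) * Gamma (\<mu> - of_nat n) * of_real (2 * y) ^ n
        = (a_coeff n (\<nu> + 1/2) * 2 ^ n) * Gamma (\<mu> - of_nat n) * of_real y ^ n"
      by (simp add: power_mult_distrib)
    also have "\<dots> = ?p n / fact n * Gamma (\<mu> - of_nat n) * ((-1) ^ n * of_real y ^ n)"
      unfolding a_coeff_pochhammer by (simp add: mult_ac)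
    also have "(-1) ^ n * of_real y ^ n = complex_of_real (-y) ^ n"
      by (simp flip: power_mult_distrib)
    finally show "?p n / fact n * Gamma (\<mu> - of_nat n) * of_real (-y) ^ n =
        a_coeff n (\<nu> + 1/2) * Gamma (\<mu> - of_nat n) * of_real (2 * y) ^ n" ..
  qed
  have "ferrers_core \<nu> \<mu> y - ?S = G * (hyp_reg (\<nu> + 1) (-\<nu>) (1 + \<mu>) (of_real (1 - y)) - ?S * r)"
    using Gr unfolding ferrers_core_def G_def[symmetric] by (simp add: right_diff_distrib mult.left_commute[of G])
  then have "norm (ferrers_core \<nu> \<mu> y - ?S) = norm G * norm (hyp_reg (\<nu> + 1) (-\<nu>) (1 + \<mu>) (of_real (1 - y)) - ?S * r)"
    by (simp only: norm_mult)
  also have "\<dots> \<le> norm G * (3 * norm (?p N) / fact N * norm (Gamma (\<mu> - of_nat N) * r) * y ^ N)"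
    by (intro mult_left_mono main) auto
  also have "\<dots> = 3 * norm (?p N) / fact N * (norm (Gamma (\<mu> - of_nat N)) * norm (G * r)) * y ^ N"
    by (simp only: norm_mult mult_ac times_divide_eq_left times_divide_eq_right)
  also have "\<dots> = 3 * (norm (?p N) / fact N) * (norm (Gamma (\<mu> - of_nat N)) * y ^ N)"
    by (simp add: Gr)
  also have "\<dots> \<le> 3 * (A ^ N * A ^ N) * (norm (Gamma (\<mu> - of_nat N)) * (2 * y) ^ N)"
  proof (intro mult_mono)
    show "y ^ N \<le> (2 * y) ^ N" using y by (intro power_mono) auto
    have "norm (?p N) / fact N \<le> norm (?p N) / 1"
      by (intro divide_left_mono) auto
    also have "\<dots> \<le> A ^ N * A ^ N"
      using norm_pochhammer_le[OF b(1)] norm_pochhammer_le[OF b(2)] A0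
      by (simp only: norm_mult div_by_1) (intro mult_mono; simp)
    finally show "norm (?p N) / fact N \<le> A ^ N * A ^ N" .
  qed (use y A0 in auto)
  finally show ?thesis unfolding S .
qed

text \<open>Reduces an expansion to an exact identity between \<open>f\<close> and two values of
  \<open>ferrers_core\<close>. Each core is expanded separately, which makes the truncation orders
  independent, and the prefactors \<open>A\<close> and \<open>B\<close> are never estimated.\<close>

lemma inverse_factorial_expansionI:
  assumes V: "bounded V"
    and X: "\<And>\<zeta>. \<zeta> \<in> Z \<Longrightarrow> 0 \<le> X \<zeta> \<and> X \<zeta> \<le> 2" and Y: "\<And>\<zeta>. \<zeta> \<in> Z \<Longrightarrow> 0 \<le> Y \<zeta> \<and> Y \<zeta> \<le> 2"
    and f: "\<And>\<zeta> \<nu> \<mu>. \<zeta> \<in> Z \<Longrightarrow> \<nu> \<in> V \<Longrightarrow> Re \<mu> \<ge> R \<Longrightarrow>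
      f \<zeta> \<nu> \<mu> = A \<zeta> \<nu> \<mu> * ferrers_core \<nu> \<mu> (X \<zeta> / 2) + B \<zeta> \<nu> \<mu> * ferrers_core \<nu> \<mu> (Y \<zeta> / 2)"
  shows "inverse_factorial_expansion Z V T f A X B Y"
  unfolding inverse_factorial_expansion_def
proof (intro allI)
  fix N M
  obtain K where K: "\<And>\<nu>. \<nu> \<in> V \<Longrightarrow> norm \<nu> \<le> K" using V by (auto simp: bounded_iff)
  \<comment> \<open>Each truncation order has its own parameter bound. Neither depends on
    \<open>\<nu>\<close>, so \<open>C\<close> and \<open>R'\<close> are uniform over
    \<open>V\<close>.\<close>
  define a b where "a = \<bar>K\<bar> + 1 + real N" and "b = \<bar>K\<bar> + 1 + real M"
  define C where "C = max (3 * (a ^ N * a ^ N)) (3 * (b ^ M * b ^ M))"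
  define R' where "R' = max R (max (6 * a\<^sup>2 + 6 * a + 1) (6 * b\<^sup>2 + 6 * b + 1))"
  let ?S = "\<lambda>N \<zeta> \<nu> \<mu> X. (\<Sum>n<N. a_coeff n (\<nu> + 1/2) * Gamma (\<mu> - of_nat n) * of_real (X \<zeta>) ^ n)"
  show "\<exists>C R. \<forall>\<zeta>\<in>Z. \<forall>\<nu>\<in>V. \<forall>\<mu>. Im \<mu> \<in> T \<and> Re \<mu> \<ge> R \<longrightarrow>
        (\<exists>E\<^sub>1 E\<^sub>2.
           norm E\<^sub>1 \<le> C * (norm (Gamma (\<mu> - of_nat N)) * \<bar>X \<zeta>\<bar> ^ N) \<and>
           norm E\<^sub>2 \<le> C * (norm (Gamma (\<mu> - of_nat M)) * \<bar>Y \<zeta>\<bar> ^ M) \<and>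
           f \<zeta> \<nu> \<mu> = A \<zeta> \<nu> \<mu> * (?S N \<zeta> \<nu> \<mu> X + E\<^sub>1) + B \<zeta> \<nu> \<mu> * (?S M \<zeta> \<nu> \<mu> Y + E\<^sub>2))"
  proof (rule exI[of _ C], rule exI[of _ R'], intro ballI allI impI)
    fix \<zeta> \<nu> \<mu> assume *: "\<zeta> \<in> Z" "\<nu> \<in> V" "Im \<mu> \<in> T \<and> R' \<le> Re \<mu>"
    let ?E1 = "ferrers_core \<nu> \<mu> (X \<zeta> / 2) - ?S N \<zeta> \<nu> \<mu> X"
    let ?E2 = "ferrers_core \<nu> \<mu> (Y \<zeta> / 2) - ?S M \<zeta> \<nu> \<mu> Y"
    have ab: "norm \<nu> + 1 + of_nat N \<le> a" "norm \<nu> + 1 + of_nat M \<le> b"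
      using K[OF *(2)] by (auto simp: a_def b_def)
    have re: "Re \<mu> \<ge> 6 * a\<^sup>2 + 6 * a + 1" "Re \<mu> \<ge> 6 * b\<^sup>2 + 6 * b + 1" "Re \<mu> \<ge> R"
      using *(3) by (auto simp: R'_def)
    have "norm ?E1 \<le> 3 * (a ^ N * a ^ N) * (norm (Gamma (\<mu> - of_nat N)) * \<bar>X \<zeta>\<bar> ^ N)"
      using ferrers_core_expansion[OF ab(1) re(1), of "X \<zeta> / 2"] X[OF *(1)] by simp
    also have "\<dots> \<le> C * (norm (Gamma (\<mu> - of_nat N)) * \<bar>X \<zeta>\<bar> ^ N)"
      by (intro mult_right_mono) (auto simp: C_def)
    finally have E1: "norm ?E1 \<le> C * (norm (Gamma (\<mu> - of_nat N)) * \<bar>X \<zeta>\<bar> ^ N)" .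
    have "norm ?E2 \<le> 3 * (b ^ M * b ^ M) * (norm (Gamma (\<mu> - of_nat M)) * \<bar>Y \<zeta>\<bar> ^ M)"
      using ferrers_core_expansion[OF ab(2) re(2), of "Y \<zeta> / 2"] Y[OF *(1)] by simp
    also have "\<dots> \<le> C * (norm (Gamma (\<mu> - of_nat M)) * \<bar>Y \<zeta>\<bar> ^ M)"
      by (intro mult_right_mono) (auto simp: C_def)
    finally have E2: "norm ?E2 \<le> C * (norm (Gamma (\<mu> - of_nat M)) * \<bar>Y \<zeta>\<bar> ^ M)" .
    show "\<exists>E\<^sub>1 E\<^sub>2.
           norm E\<^sub>1 \<le> C * (norm (Gamma (\<mu> - of_nat N)) * \<bar>X \<zeta>\<bar> ^ N) \<and>
           norm E\<^sub>2 \<le> C * (norm (Gamma (\<mu> - of_nat M)) * \<bar>Y \<zeta>\<bar> ^ M) \<and>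
           f \<zeta> \<nu> \<mu> = A \<zeta> \<nu> \<mu> * (?S N \<zeta> \<nu> \<mu> X + E\<^sub>1) + B \<zeta> \<nu> \<mu> * (?S M \<zeta> \<nu> \<mu> Y + E\<^sub>2)"
      by (rule exI[of _ ?E1], rule exI[of _ ?E2], intro conjI E1 E2)
         (simp add: f[OF *(1,2) re(3)])
  qed
qed

text \<open>With \<open>s\<close> in the role of \<open>w\<close>, the squares of
  \<open>cot (\<zeta> / 2)\<close> and \<open>tan (\<zeta> / 2)\<close> are
  \<open>(1 - s) / s\<close> and its inverse. All bases are positive, so logarithms are real and
  every power becomes a \<open>legendre_factor\<close>.\<close>

lemma half_angle_facts:
  fixes \<zeta> :: real
  assumes "0 < \<zeta>" "\<zeta> < pi"
  defines "s \<equiv> (sin (\<zeta> / 2))\<^sup>2"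
  shows "0 < s" "s < 1" "(cos (\<zeta> / 2))\<^sup>2 = 1 - s" "(1 - cos \<zeta>) / 2 = s"
    "of_real ((1 + cos \<zeta>) / (1 - cos \<zeta>)) powr (\<mu> / 2) = legendre_factor \<mu> (of_real s)"
    "of_real ((1 - cos \<zeta>) / (1 + cos \<zeta>)) powr (\<mu> / 2) = legendre_factor (-\<mu>) (of_real s)"
    "of_real (cot (\<zeta> / 2)) powr \<mu> = legendre_factor \<mu> (of_real s)"
    "of_real (tan (\<zeta> / 2)) powr \<mu> = legendre_factor (-\<mu>) (of_real s)"
proof -
  have pos: "sin (\<zeta> / 2) > 0" "cos (\<zeta> / 2) > 0"
    using assms by (auto intro!: sin_gt_zero cos_gt_zero)
  show s0: "0 < s" using pos by (simp add: s_def)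
  show c: "(cos (\<zeta> / 2))\<^sup>2 = 1 - s" by (simp add: s_def cos_squared_eq)
  then show s1: "s < 1" using pos by (metis diff_gt_0_iff_gt zero_less_power)
  have "cos \<zeta> = 1 - 2 * s" using cos_double_sin[of "\<zeta> / 2"] by (simp add: s_def)
  then have cosz: "1 - cos \<zeta> = 2 * s" "1 + cos \<zeta> = 2 * (1 - s)" by simp_all
  then show "(1 - cos \<zeta>) / 2 = s" by simp
  have F: "of_real (q powr (1/2)) powr \<mu> = legendre_factor \<mu> (of_real s)" 
      "of_real q powr (\<mu> / 2) = legendre_factor \<mu> (of_real s)" if "q = (1 - s) / s" for q \<mu>
  proof -
    have q: "q > 0" "ln q = ln (1 - s) - ln s" using that s0 s1 by (auto simp: ln_div)
    have Lns: "Ln (1 - of_real s) = of_real (ln (1 - s))" "Ln (of_real s) = of_real (ln s)"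
      using s0 s1 Ln_of_real[of "1 - s"] Ln_of_real[of s] by auto
    have "complex_of_real t powr \<mu> = exp (\<mu> * of_real (ln t))" if "t > 0" for t
      using that by (simp add: powr_def Ln_of_real)
    then have "of_real (q powr (1/2)) powr \<mu> = exp (\<mu> * of_real (ln (q powr (1/2))))"
      using q by simp
    then show "of_real (q powr (1/2)) powr \<mu> = legendre_factor \<mu> (of_real s)"
      using q by (simp add: legendre_factor_def ln_powr Lns mult_ac)
    show "of_real q powr (\<mu> / 2) = legendre_factor \<mu> (of_real s)"
      using q by (simp add: legendre_factor_def powr_def Ln_of_real Lns mult_ac)
  qed
  have F': "of_real (q powr (1/2)) powr \<mu> = legendre_factor (-\<mu>) (of_real s)" 
      "of_real q powr (\<mu> / 2) = legendre_factor (-\<mu>) (of_real s)" if "q = s / (1 - s)" for q \<mu>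
  proof -
    have q: "q > 0" "ln q = ln s - ln (1 - s)" using that s0 s1 by (auto simp: ln_div)
    have Lns: "Ln (1 - of_real s) = of_real (ln (1 - s))" "Ln (of_real s) = of_real (ln s)"
      using s0 s1 Ln_of_real[of "1 - s"] Ln_of_real[of s] by auto
    have LF: "legendre_factor (-\<mu>) (of_real s) = exp (\<mu> / 2 * (of_real (ln s) - of_real (ln (1 - s))))"
      by (simp add: legendre_factor_def Lns right_diff_distrib)
    have "complex_of_real t powr \<mu> = exp (\<mu> * of_real (ln t))" if "t > 0" for t
      using that by (simp add: powr_def Ln_of_real)
    then have "of_real (q powr (1/2)) powr \<mu> = exp (\<mu> * of_real (ln (q powr (1/2))))"
      using q by simp
    then show "of_real (q powr (1/2)) powr \<mu> = legendre_factor (-\<mu>) (of_real s)"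
      using q by (simp add: LF ln_powr mult_ac)
    show "of_real q powr (\<mu> / 2) = legendre_factor (-\<mu>) (of_real s)"
      using q by (simp add: LF powr_def Ln_of_real mult_ac)
  qed
  have ct: "cot (\<zeta> / 2) = ((1 - s) / s) powr (1/2)" "tan (\<zeta> / 2) = (s / (1 - s)) powr (1/2)"
  proof -
    have "sin (\<zeta> / 2) = sqrt s" "cos (\<zeta> / 2) = sqrt (1 - s)"
      using pos unfolding c[symmetric] by (simp_all add: s_def)
    then show "cot (\<zeta> / 2) = ((1 - s) / s) powr (1/2)" "tan (\<zeta> / 2) = (s / (1 - s)) powr (1/2)"
      using s0 s1 by (simp_all add: cot_def tan_def powr_half_sqrt real_sqrt_divide)
  qed
  show "of_real ((1 + cos \<zeta>) / (1 - cos \<zeta>)) powr (\<mu> / 2) = legendre_factor \<mu> (of_real s)"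
    by (rule F(2)) (simp only: cosz mult_divide_mult_cancel_left_if, simp)
  show "of_real ((1 - cos \<zeta>) / (1 + cos \<zeta>)) powr (\<mu> / 2) = legendre_factor (-\<mu>) (of_real s)"
    by (rule F'(2)) (simp only: cosz mult_divide_mult_cancel_left_if, simp)
  show "of_real (cot (\<zeta> / 2)) powr \<mu> = legendre_factor \<mu> (of_real s)"
    unfolding ct by (rule F(1)) simp
  show "of_real (tan (\<zeta> / 2)) powr \<mu> = legendre_factor (-\<mu>) (of_real s)"
    unfolding ct by (rule F'(1)) simp
qed

subsection \<open>Ferrers functions\<close>

text \<open>The connection formula at \<open>s\<close>, multiplied by the two Gamma functions. As
  \<open>ferrers_core\<close> evaluates its series at \<open>1 - y\<close>, the cotangent term
  carries the sine and the tangent term the cosine.\<close>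

lemma ferrers_P_eq:
  assumes A: "norm \<nu> + 2 \<le> A" and \<mu>: "Re \<mu> \<ge> 6 * A\<^sup>2 + 6 * A + 1" and \<zeta>: "0 < \<zeta>" "\<zeta> < pi"
  shows "ferrers_P \<nu> \<mu> (cos \<zeta>) =
      sin (of_real pi * \<mu>) / of_real pi * of_real (cot (\<zeta> / 2)) powr \<mu> * ferrers_core \<nu> \<mu> ((sin (\<zeta> / 2))\<^sup>2)
    + - (sin (of_real pi * \<nu>) / of_real pi) * of_real (tan (\<zeta> / 2)) powr \<mu> * ferrers_core \<nu> \<mu> ((cos (\<zeta> / 2))\<^sup>2)"
proof -
  define s where "s = (sin (\<zeta> / 2))\<^sup>2"
  note h = half_angle_facts[OF \<zeta>, folded s_def]
  have A0: "A \<ge> 0" using A norm_ge_zero[of \<nu>] by linarith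
  have pos: "Re (\<mu> - \<nu>) > 0" "Re (\<mu> + \<nu> + 1) > 0"
    using \<mu> A A0 complex_Re_le_cmod[of \<nu>] complex_Re_le_cmod[of "-\<nu>"] zero_le_power2[of A]
    unfolding plus_complex.sel minus_complex.sel one_complex.sel uminus_complex.sel norm_minus_cancel by linarith+
  define G where "G = Gamma (\<mu> + \<nu> + 1) * Gamma (\<mu> - \<nu>)"
  define r where "r = rGamma (\<mu> - \<nu>) * rGamma (\<mu> + \<nu> + 1)"
  have Gr: "G * r = 1"
    using Gamma_rGamma_cancel[OF pos(1)] Gamma_rGamma_cancel[OF pos(2)]
    unfolding G_def r_def by (simp add: mult_ac)
  have "ferrers_P \<nu> \<mu> (cos \<zeta>) = G * r * (legendre_factor \<mu> (of_real s) * hyp_reg (\<nu> + 1) (-\<nu>) (1 - \<mu>) (of_real s))"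
    unfolding Gr ferrers_P_def h by simp
  also have "\<dots> = G * (r * (legendre_factor \<mu> (of_real s) * hyp_reg (\<nu> + 1) (-\<nu>) (1 - \<mu>) (of_real s)))"
    by (simp only: mult.assoc)
  also have "\<dots> = G * (sin (of_real pi * \<mu>) / of_real pi * (legendre_factor \<mu> (of_real s) * hyp_reg (\<nu> + 1) (-\<nu>) (1 + \<mu>) (of_real (1 - s)))
         - sin (of_real pi * \<nu>) / of_real pi * (legendre_factor (-\<mu>) (of_real s) * hyp_reg (\<nu> + 1) (-\<nu>) (1 + \<mu>) (of_real s)))"
    unfolding r_def hyp_reg_connection[OF A \<mu> h(1,2)] ..
  finally show ?thesis
    unfolding ferrers_core_def G_def[symmetric] s_def[symmetric] h by (simp add: algebra_simps)
qed

text \<open>The first half of the formula contains \<open>ferrers_P\<close>, the second is a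
  multiple of the core at \<open>1 - s\<close>. Reflecting \<open>rGamma (\<nu> - \<mu> + 1)\<close>
  and expanding the resulting sine makes the terms with \<open>sin (\<pi> \<nu>)\<close> cancel and
  the denominator \<open>sin (\<pi> \<mu>)\<close> disappear.\<close>

lemma ferrers_Q_formula_eq:
  assumes A: "norm \<nu> + 2 \<le> A" and \<mu>: "Re \<mu> \<ge> 6 * A\<^sup>2 + 6 * A + 1" and \<zeta>: "0 < \<zeta>" "\<zeta> < pi"
    and ne: "\<mu> \<notin> \<int>"
  shows "ferrers_Q_formula \<nu> \<mu> (cos \<zeta>) =
      cos (of_real pi * \<mu>) / 2 * of_real (cot (\<zeta> / 2)) powr \<mu> * ferrers_core \<nu> \<mu> ((sin (\<zeta> / 2))\<^sup>2)
    + - (cos (of_real pi * \<nu>) / 2) * of_real (tan (\<zeta> / 2)) powr \<mu> * ferrers_core \<nu> \<mu> ((cos (\<zeta> / 2))\<^sup>2)"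
proof -
  define s where "s = (sin (\<zeta> / 2))\<^sup>2"
  note h = half_angle_facts[OF \<zeta>, folded s_def]
  have A0: "A \<ge> 0" using A norm_ge_zero[of \<nu>] by linarith
  have pos: "Re (\<mu> - \<nu>) > 0"
    using \<mu> A A0 complex_Re_le_cmod[of \<nu>] zero_le_power2[of A]
    unfolding minus_complex.sel by linarith
  define S C sn cn p where "S = sin (of_real pi * \<mu>)" and "C = cos (of_real pi * \<mu>)"
    and "sn = sin (of_real pi * \<nu>)" and "cn = cos (of_real pi * \<nu>)" and "p = complex_of_real pi"
  define K T c1 c2 where "K = of_real (cot (\<zeta> / 2)) powr \<mu>" and "T = of_real (tan (\<zeta> / 2)) powr \<mu>"
    and "c1 = ferrers_core \<nu> \<mu> s" and "c2 = ferrers_core \<nu> \<mu> (1 - s)"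
  have p0: "p \<noteq> 0" by (simp add: p_def)
  have S0: "S \<noteq> 0"
  proof
    assume "S = 0"
    then obtain n :: int where "of_real pi * \<mu> = of_real (of_int n * pi)"
      unfolding S_def sin_eq_0 by blast
    then have "\<mu> = of_int n" by simp
    with ne show False by simp
  qed
  have refl: "rGamma (\<nu> - \<mu> + 1) = Gamma (\<mu> - \<nu>) * (sin (of_real pi * (\<mu> - \<nu>)) / p)"
  proof -
    have "Gamma (\<mu> - \<nu>) * (rGamma (\<mu> - \<nu>) * rGamma (1 - (\<mu> - \<nu>))) = rGamma (1 - (\<mu> - \<nu>))"
      using Gamma_rGamma_cancel[OF pos] by (simp flip: mult.assoc)
    then show ?thesis unfolding rGamma_reflection_complex p_def by (simp add: algebra_simps)
  qed
  have sd: "sin (of_real pi * (\<mu> - \<nu>)) = S * cn - C * sn"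
    by (simp add: S_def C_def sn_def cn_def right_diff_distrib sin_diff)
  have P: "of_real ((1 + cos \<zeta>) / (1 - cos \<zeta>)) powr (\<mu> / 2) *
        hyp_reg (\<nu> + 1) (-\<nu>) (1 - \<mu>) (of_real ((1 - cos \<zeta>) / 2)) = S / p * K * c1 + - (sn / p) * T * c2"
    using ferrers_P_eq[OF A \<mu> \<zeta>] unfolding ferrers_P_def h s_def[symmetric]
    by (simp only: S_def sn_def p_def K_def T_def c1_def c2_def h)
  have second: "Gamma (\<nu> + \<mu> + 1) * rGamma (\<nu> - \<mu> + 1) *
        of_real ((1 - cos \<zeta>) / (1 + cos \<zeta>)) powr (\<mu> / 2) *
        hyp_reg (\<nu> + 1) (-\<nu>) (1 + \<mu>) (of_real ((1 - cos \<zeta>) / 2)) = (S * cn - C * sn) / p * T * c2"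
    unfolding refl sd T_def c2_def ferrers_core_def h by (simp add: add_ac)
  have "ferrers_Q_formula \<nu> \<mu> (cos \<zeta>)
      = p / (2 * S) * (C * (S / p * K * c1 + - (sn / p) * T * c2) - (S * cn - C * sn) / p * T * c2)"
    unfolding ferrers_Q_formula_def P[symmetric] second
    by (simp only: S_def C_def p_def mult.assoc)
  also have "\<dots> = C / 2 * K * c1 + - (cn / 2) * T * c2"
    using S0 p0 by (simp add: divide_simps) (simp add: algebra_simps)
  finally show ?thesis
    unfolding C_def K_def T_def c1_def c2_def cn_def s_def[symmetric] h .
qed

section \<open>Continuity in the order and the passage to integer order\<close>

lemma continuous_on_hyp_reg_parameter:
  assumes A: "norm a \<le> A" "norm b \<le> A" and w: "norm w \<le> 1"
    and K: "compact K" "\<And>c. c \<in> K \<Longrightarrow> Re c \<ge> 6 * A\<^sup>2 + 6 * A + 1"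
  shows "continuous_on K (\<lambda>c. hyp_reg a b c w)"
proof -
  have A0: "A \<ge> 0" using A(1) norm_ge_zero order_trans by blast
  have "compact (rGamma ` K)" by (intro compact_continuous_image continuous_intros K)
  then obtain B where B: "\<And>c. c \<in> K \<Longrightarrow> norm (rGamma c) \<le> B"
    by (metis bounded_iff compact_imp_bounded imageI)
  \<comment> \<open>One majorant for all \<open>k\<close>: at \<open>k = 0\<close> it equals the
    bound \<open>B\<close> of \<open>rGamma\<close>, and at \<open>k = j + 1\<close> it dominates
    the bound from \<open>norm_hyp_coeff_Suc_le\<close>.\<close>
  define M where "M = (\<lambda>k::nat. 2 * B * (1 / (of_nat (k + 1) * of_nat (k + 2))) :: real)"
  have "summable (\<lambda>k. M (Suc k))"
    unfolding M_def using sums_summable[OF sums_inverse_product] by (intro summable_mult) (simp add: add_ac)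
  then have M: "summable M" by (subst (asm) summable_Suc_iff)
  have "uniform_limit K (\<lambda>n c. \<Sum>k<n. hyp_coeff a b c k * w ^ k) (\<lambda>c. hyp_reg a b c w) sequentially"
    unfolding hyp_reg_altdef
  proof (rule Weierstrass_m_test[OF _ M])
    fix k c assume c: "c \<in> K"
    have B0: "B \<ge> 0" using B[OF c] norm_ge_zero order_trans by blast
    have "norm w ^ k \<le> 1" using w by (simp add: power_le_one)
    then have "norm (hyp_coeff a b c k * w ^ k) \<le> norm (hyp_coeff a b c k)"
      by (simp add: norm_mult norm_power mult_left_le)
    also have "\<dots> \<le> M k"
    proof (cases k)
      case 0
      then show ?thesis using B[OF c] by (simp add: M_def)
    next
      case (Suc j)
      have "0 \<le> A\<^sup>2" by simp
      then have "Re c > 0" using K(2)[OF c] A0 by linarith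
      then have "6 * A\<^sup>2 / Re c \<le> 1" using K(2)[OF c] A0 by (simp add: pos_divide_le_eq)
      then have "norm (rGamma c) * (6 * A\<^sup>2 / Re c) \<le> B * 1"
        using B[OF c] B0 \<open>Re c > 0\<close> by (intro mult_mono) auto
      then have "norm (rGamma c) * (6 * A\<^sup>2 / Re c) / (of_nat (j + 2) * of_nat (j + 3)) \<le> 2 * B / (of_nat (j + 2) * of_nat (j + 3))"
        using B0 by (intro divide_right_mono) auto
      then show ?thesis using norm_hyp_coeff_Suc_le[OF A K(2)[OF c], of j] unfolding Suc M_def
        by (simp add: add_ac)
    qed
    finally show "norm (hyp_coeff a b c k * w ^ k) \<le> M k" .
  qed
  then show ?thesis
    by (rule uniform_limit_theorem[rotated])
       (auto intro!: always_eventually continuous_intros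
          continuous_on_compose2[OF continuous_on_rGamma[of UNIV]] simp: hyp_coeff_def)
qed

lemma isCont_ferrers_core:
  assumes A: "norm \<nu> + 2 \<le> A" and \<mu>: "Re \<mu> \<ge> 6 * A\<^sup>2 + 6 * A + 2" and y: "0 \<le> y" "y \<le> 1"
  shows "isCont (\<lambda>m. ferrers_core \<nu> m y) \<mu>"
proof -
  have A0: "A \<ge> 0" using A norm_ge_zero[of \<nu>] by linarith
  \<comment> \<open>The constant 2 in the hypothesis, against 1 here, leaves room for a whole unit
    disc around \<open>\<mu>\<close>.\<close>
  have re: "Re m \<ge> 6 * A\<^sup>2 + 6 * A + 1" if "m \<in> cball \<mu> 1" for m
    using that abs_Re_le_cmod[of "\<mu> - m"] \<mu> by (simp add: dist_norm)
  have b: "norm (\<nu> + 1) \<le> A" "norm (-\<nu>) \<le> A"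
    using A norm_triangle_ineq[of \<nu> 1] by auto
  have "continuous_on ((\<lambda>m. 1 + m) ` cball \<mu> 1) (\<lambda>c. hyp_reg (\<nu> + 1) (-\<nu>) c (of_real (1 - y)))"
  proof (rule continuous_on_hyp_reg_parameter[OF b])
    show "norm (complex_of_real (1 - y)) \<le> 1" using y by (simp add: norm_of_real del: of_real_diff)
    show "compact ((\<lambda>m. 1 + m) ` cball \<mu> 1)" by (intro compact_continuous_image continuous_intros compact_cball)
    show "Re c \<ge> 6 * A\<^sup>2 + 6 * A + 1" if "c \<in> (\<lambda>m. 1 + m) ` cball \<mu> 1" for c
      using that re by force
  qed
  then have "continuous_on (cball \<mu> 1) (\<lambda>m. hyp_reg (\<nu> + 1) (-\<nu>) (1 + m) (of_real (1 - y)))"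
    by (rule continuous_on_compose2) (auto intro!: continuous_intros)
  then have h: "isCont (\<lambda>m. hyp_reg (\<nu> + 1) (-\<nu>) (1 + m) (of_real (1 - y))) \<mu>"
    by (rule continuous_on_interior) simp
  have "Re \<mu> \<ge> 6 * A\<^sup>2 + 6 * A + 1" using \<mu> by simp
  then have pos: "Re (\<mu> - \<nu>) > 0" "Re (\<mu> + \<nu> + 1) > 0"
    using A A0 complex_Re_le_cmod[of \<nu>] complex_Re_le_cmod[of "-\<nu>"] zero_le_power2[of A]
    unfolding plus_complex.sel minus_complex.sel one_complex.sel uminus_complex.sel norm_minus_cancel by linarith+
  have nn: "\<mu> - \<nu> \<notin> \<int>\<^sub>\<le>\<^sub>0" "\<mu> + \<nu> + 1 \<notin> \<int>\<^sub>\<le>\<^sub>0"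
    using pos by (auto elim!: nonpos_Ints_cases simp del: plus_complex.sel minus_complex.sel)
  have "isCont (\<lambda>m. Gamma (m + \<nu> + 1)) \<mu>" "isCont (\<lambda>m. Gamma (m - \<nu>)) \<mu>"
    using nn by (auto intro!: isCont_Gamma continuous_intros)
  then show ?thesis unfolding ferrers_core_def by (intro isCont_mult h)
qed

text \<open>At integer order \<open>ferrers_Q\<close> is a limit of the formula. The right-hand side
  is continuous there and agrees with the formula on the punctured unit disc, which contains no
  integer.\<close>

lemma ferrers_Q_eq:
  assumes A: "norm \<nu> + 2 \<le> A" and \<mu>: "Re \<mu> \<ge> 6 * A\<^sup>2 + 6 * A + 2" and \<zeta>: "0 < \<zeta>" "\<zeta> < pi"
  shows "ferrers_Q \<nu> \<mu> (cos \<zeta>) =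
      cos (of_real pi * \<mu>) / 2 * of_real (cot (\<zeta> / 2)) powr \<mu> * ferrers_core \<nu> \<mu> ((sin (\<zeta> / 2))\<^sup>2)
    + - (cos (of_real pi * \<nu>) / 2) * of_real (tan (\<zeta> / 2)) powr \<mu> * ferrers_core \<nu> \<mu> ((cos (\<zeta> / 2))\<^sup>2)"
    (is "_ = ?rhs \<mu>")
proof (cases "\<mu> \<in> \<int>")
  case False
  then show ?thesis using ferrers_Q_formula_eq[OF A _ \<zeta> False] \<mu> by (simp add: ferrers_Q_def)
next
  case True
  have pos: "cot (\<zeta> / 2) > 0" "tan (\<zeta> / 2) > 0"
    using \<zeta> by (auto intro!: cot_gt_zero tan_gt_zero)
  have "isCont (\<lambda>m. complex_of_real t powr m) \<mu>" if "t > 0" for t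
    using that by (auto simp: powr_def intro!: continuous_intros)
  then have "isCont ?rhs \<mu>"
    using pos
    by (intro continuous_intros isCont_ferrers_core[OF A \<mu>]) (auto simp: power_le_one_iff abs_square_le_1)
  then have lim: "(?rhs \<longlongrightarrow> ?rhs \<mu>) (at \<mu>)" by (simp add: isCont_def)
  have "\<forall>\<^sub>F m in at \<mu>. ferrers_Q_formula \<nu> m (cos \<zeta>) = ?rhs m"
    unfolding eventually_at
  proof (intro exI[of _ 1] conjI ballI impI)
    fix m assume m: "m \<noteq> \<mu> \<and> dist m \<mu> < 1"
    have re: "Re m \<ge> 6 * A\<^sup>2 + 6 * A + 1"
      using conjunct2[OF m] abs_Re_le_cmod[of "m - \<mu>"] \<mu> by (simp add: dist_norm)
    have "m \<notin> \<int>"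
    proof
      assume "m \<in> \<int>"
      then obtain i j :: int where ij: "m = of_int i" "\<mu> = of_int j" using True by (auto elim!: Ints_cases)
      then have "norm (of_int (i - j) :: complex) < 1" using m by (simp add: dist_norm)
      then have "\<bar>i - j\<bar> < 1" unfolding norm_of_int by linarith
      with ij m show False by simp
    qed
    then show "ferrers_Q_formula \<nu> m (cos \<zeta>) = ?rhs m"
      by (rule ferrers_Q_formula_eq[OF A re \<zeta>])
  qed simp
  then have "((\<lambda>m. ferrers_Q_formula \<nu> m (cos \<zeta>)) \<longlongrightarrow> ?rhs \<mu>) (at \<mu>)"
    using lim by (simp add: tendsto_cong)
  then show ?thesis using True by (simp add: ferrers_Q_def tendsto_Lim)
qed

theorem mainTheorem16:
  fixes \<epsilon> :: real and V :: "complex set" and T :: "real set"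
  assumes "\<epsilon> > 0" and "bounded V" and "bounded T"
  shows "inverse_factorial_expansion {\<epsilon>..pi - \<epsilon>} V T
           (\<lambda>\<zeta> \<nu> \<mu>. ferrers_P \<nu> \<mu> (cos \<zeta>))
           (\<lambda>\<zeta> \<nu> \<mu>. sin (of_real pi * \<mu>) / of_real pi * of_real (cot (\<zeta> / 2)) powr \<mu>)
           (\<lambda>\<zeta>. 2 * (sin (\<zeta> / 2))\<^sup>2)
           (\<lambda>\<zeta> \<nu> \<mu>. - (sin (of_real pi * \<nu>) / of_real pi) * of_real (tan (\<zeta> / 2)) powr \<mu>)
           (\<lambda>\<zeta>. 2 * (cos (\<zeta> / 2))\<^sup>2)
       \<and> inverse_factorial_expansion {\<epsilon>..pi - \<epsilon>} V T
           (\<lambda>\<zeta> \<nu> \<mu>. ferrers_Q \<nu> \<mu> (cos \<zeta>))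
           (\<lambda>\<zeta> \<nu> \<mu>. cos (of_real pi * \<mu>) / 2 * of_real (cot (\<zeta> / 2)) powr \<mu>)
           (\<lambda>\<zeta>. 2 * (sin (\<zeta> / 2))\<^sup>2)
           (\<lambda>\<zeta> \<nu> \<mu>. - (cos (of_real pi * \<nu>) / 2) * of_real (tan (\<zeta> / 2)) powr \<mu>)
           (\<lambda>\<zeta>. 2 * (cos (\<zeta> / 2))\<^sup>2)"
proof -
  obtain K where K: "\<And>\<nu>. \<nu> \<in> V \<Longrightarrow> norm \<nu> \<le> K"
    using \<open>bounded V\<close> by (auto simp: bounded_iff)
  \<comment> \<open>One bound for all of \<open>V\<close>, hence one threshold for
    \<open>Re \<mu>\<close>. The threshold chosen below is that of \<open>ferrers_Q_eq\<close>,
    which implies that of \<open>ferrers_P_eq\<close>.\<close>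
  define A where "A = K + 2"
  have A: "norm \<nu> + 2 \<le> A" if "\<nu> \<in> V" for \<nu> using K[OF that] by (simp add: A_def)
  have \<zeta>: "0 < \<zeta>" "\<zeta> < pi" if "\<zeta> \<in> {\<epsilon>..pi - \<epsilon>}" for \<zeta> using that \<open>\<epsilon> > 0\<close> by auto
  show ?thesis
  proof (intro conjI inverse_factorial_expansionI[where R = "6 * A\<^sup>2 + 6 * A + 2"] \<open>bounded V\<close>)
    fix \<zeta> \<nu> \<mu> assume *: "\<zeta> \<in> {\<epsilon>..pi - \<epsilon>}" "\<nu> \<in> V" "6 * A\<^sup>2 + 6 * A + 2 \<le> Re \<mu>"
    show "ferrers_P \<nu> \<mu> (cos \<zeta>) =
        sin (of_real pi * \<mu>) / of_real pi * of_real (cot (\<zeta> / 2)) powr \<mu> * ferrers_core \<nu> \<mu> (2 * (sin (\<zeta> / 2))\<^sup>2 / 2)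
      + - (sin (of_real pi * \<nu>) / of_real pi) * of_real (tan (\<zeta> / 2)) powr \<mu> * ferrers_core \<nu> \<mu> (2 * (cos (\<zeta> / 2))\<^sup>2 / 2)"
      using ferrers_P_eq[OF A[OF *(2)] _ \<zeta>[OF *(1)], of \<mu>] *(3) by simp
    show "ferrers_Q \<nu> \<mu> (cos \<zeta>) =
        cos (of_real pi * \<mu>) / 2 * of_real (cot (\<zeta> / 2)) powr \<mu> * ferrers_core \<nu> \<mu> (2 * (sin (\<zeta> / 2))\<^sup>2 / 2)
      + - (cos (of_real pi * \<nu>) / 2) * of_real (tan (\<zeta> / 2)) powr \<mu> * ferrers_core \<nu> \<mu> (2 * (cos (\<zeta> / 2))\<^sup>2 / 2)"
      using ferrers_Q_eq[OF A[OF *(2)] *(3) \<zeta>[OF *(1)]] by simp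
  qed (simp_all add: abs_square_le_1)
qed

end
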